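(* Let $k$ be an algebraically closed field of characteristic zero, let $n\ge 1$, and let $A=k^{[n]}$. The following two statements are equivalent. $SC(n)$: For every $f\in A$ such that $A/(f-\lambda)\cong k^{[n-1]}$ for all $\lambda\in k$, the element $f$ is a coordinate of $A$. $MSC(n)$: For every $f\in A$ such that $A/(f-\alpha)\cong k^{[n-1]}$ for all $\alpha\in k$, there exist $n-1$ commuting locally nilpotent derivations $D_1,\dots,D_{n-1}$ on $A$ such that $A^{D_1,\dots,D_{n-1}}=k[f]$ and, for each $\alpha\in k$, the $D_i$ are linearly independent modulo $(f-\alpha)$.
   Context: $k^{[m]}$ denotes the polynomial ring in $m$ variables over $k$; isomorphisms are of $k$-algebras and derivations are $k$-derivations. $A^{D_1,\dots,D_{n-1}}=\ker D_1\cap\cdots\cap\ker D_{n-1}$. "Linearly independent modulo $(f-\alpha)$" means that the derivations of $A/(f-\alpha)$ induced by $D_1,\dots,D_{n-1}$ are linearly independent over $A/(f-\alpha)$. An element $f\in k^{[n]}$ is a coordinate if there exist $f_2,\dots,f_n$ with $k[f,f_2,\dots,f_n]=k^{[n]}$. *)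

theory Defs
  imports
    "HOL-Library.Poly_Mapping"
    "HOL-Computational_Algebra.Polynomial"
    "HOL-Algebra.QuotRing"
    "HOL-Algebra.Generated_Rings"
begin

text \<open>
  Finitely supported maps from exponent vectors to coefficients, with the convolution product of
  \<^theory>\<open>HOL-Library.Poly_Mapping\<close>, are the polynomials in the countably many variables
  \<open>x\<^sub>0, x\<^sub>1, \<dots>\<close>; \<open>k\<^sup>[\<^sup>n\<^sup>]\<close> is the subring of those in which only \<open>x\<^sub>0, \<dots>, x\<^bsub>n-1\<^esub>\<close> occur.
\<close>

type_synonym 'k mvpoly = "(nat \<Rightarrow>\<^sub>0 nat) \<Rightarrow>\<^sub>0 'k"

definition mvconst :: "'k::field \<Rightarrow> 'k mvpoly"
  where "mvconst c = Poly_Mapping.single 0 c"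

definition mvvars :: "'k::field mvpoly \<Rightarrow> nat set"
  where "mvvars p = (\<Union>m\<in>Poly_Mapping.keys p. Poly_Mapping.keys m)"

definition mvpoly_ring :: "nat \<Rightarrow> 'k::field mvpoly ring"
  where "mvpoly_ring n =
    \<lparr>carrier = {p. mvvars p \<subseteq> {..<n}}, mult = (*), one = 1, zero = 0, add = (+)\<rparr>"

text \<open>
  A \<open>k\<close>-algebra is a ring \<open>R\<close> together with its structure map \<open>\<sigma>\<close> from \<open>k\<close> to \<open>R\<close>.
\<close>

definition k_alg_iso ::
    "('a, 'c) ring_scheme \<Rightarrow> ('k \<Rightarrow> 'a) \<Rightarrow> ('b, 'd) ring_scheme \<Rightarrow> ('k \<Rightarrow> 'b) \<Rightarrow> bool"
  where "k_alg_iso R \<sigma> S \<tau> \<longleftrightarrow> (\<exists>h\<in>ring_iso R S. \<forall>c. h (\<sigma> c) = \<tau> c)"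

definition k_subalgebra :: "('a, 'c) ring_scheme \<Rightarrow> ('k \<Rightarrow> 'a) \<Rightarrow> 'a set \<Rightarrow> 'a set"
  where "k_subalgebra R \<sigma> S = generate_ring R (\<sigma> ` UNIV \<union> S)"

definition k_derivation :: "('a, 'c) ring_scheme \<Rightarrow> ('k \<Rightarrow> 'a) \<Rightarrow> ('a \<Rightarrow> 'a) \<Rightarrow> bool"
  where "k_derivation R \<sigma> D \<longleftrightarrow>
    D \<in> carrier R \<rightarrow> carrier R \<and>
    (\<forall>a\<in>carrier R. \<forall>b\<in>carrier R. D (a \<oplus>\<^bsub>R\<^esub> b) = D a \<oplus>\<^bsub>R\<^esub> D b) \<and>
    (\<forall>a\<in>carrier R. \<forall>b\<in>carrier R. D (a \<otimes>\<^bsub>R\<^esub> b) = a \<otimes>\<^bsub>R\<^esub> D b \<oplus>\<^bsub>R\<^esub> D a \<otimes>\<^bsub>R\<^esub> b) \<and>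
    (\<forall>c. D (\<sigma> c) = \<zero>\<^bsub>R\<^esub>)"

definition locally_nilpotent :: "('a, 'c) ring_scheme \<Rightarrow> ('a \<Rightarrow> 'a) \<Rightarrow> bool"
  where "locally_nilpotent R D \<longleftrightarrow> (\<forall>a\<in>carrier R. \<exists>m. (D ^^ m) a = \<zero>\<^bsub>R\<^esub>)"

text \<open>The empty family has common kernel \<^term>\<open>carrier R\<close>.\<close>

definition common_kernel :: "('a, 'c) ring_scheme \<Rightarrow> nat \<Rightarrow> (nat \<Rightarrow> 'a \<Rightarrow> 'a) \<Rightarrow> 'a set"
  where "common_kernel R m D = {a \<in> carrier R. \<forall>i<m. D i a = \<zero>\<^bsub>R\<^esub>}"

text \<open>
  The map on cosets of \<open>I\<close> induced by \<open>D\<close>; it sends \<open>I + a\<close> to \<open>I + D a\<close> as soon as \<open>D\<close> is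
  additive and maps the ideal \<open>I\<close> into itself, see \<open>induced_map_coset\<close>.
\<close>

definition induced_map :: "('a, 'c) ring_scheme \<Rightarrow> 'a set \<Rightarrow> ('a \<Rightarrow> 'a) \<Rightarrow> 'a set \<Rightarrow> 'a set"
  where "induced_map R I D X = (\<Union>a\<in>X. I +>\<^bsub>R\<^esub> D a)"

definition lin_indep_maps :: "('a, 'c) ring_scheme \<Rightarrow> nat \<Rightarrow> (nat \<Rightarrow> 'a \<Rightarrow> 'a) \<Rightarrow> bool"
  where "lin_indep_maps R m E \<longleftrightarrow>
    (\<forall>c \<in> {..<m} \<rightarrow> carrier R.
      (\<forall>x\<in>carrier R. (\<Oplus>\<^bsub>R\<^esub>i\<in>{..<m}. c i \<otimes>\<^bsub>R\<^esub> E i x) = \<zero>\<^bsub>R\<^esub>) \<longrightarrow>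
      (\<forall>i<m. c i = \<zero>\<^bsub>R\<^esub>))"

abbreviation fibre_ideal :: "nat \<Rightarrow> 'k::field mvpoly \<Rightarrow> 'k \<Rightarrow> 'k mvpoly set"
  where "fibre_ideal n f \<alpha> \<equiv> PIdl\<^bsub>mvpoly_ring n\<^esub> (f - mvconst \<alpha>)"

abbreviation fibre_ring :: "nat \<Rightarrow> 'k::field mvpoly \<Rightarrow> 'k \<Rightarrow> 'k mvpoly set ring"
  where "fibre_ring n f \<alpha> \<equiv> mvpoly_ring n Quot fibre_ideal n f \<alpha>"

definition all_fibres_affine :: "nat \<Rightarrow> 'k::field mvpoly \<Rightarrow> bool"
  where "all_fibres_affine n f \<longleftrightarrow>
    (\<forall>\<alpha>. k_alg_iso (fibre_ring n f \<alpha>) (\<lambda>c. fibre_ideal n f \<alpha> +>\<^bsub>mvpoly_ring n\<^esub> mvconst c)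
                    (mvpoly_ring (n - 1)) mvconst)"

definition coordinate :: "nat \<Rightarrow> 'k::field mvpoly \<Rightarrow> bool"
  where "coordinate n f \<longleftrightarrow>
    (\<exists>g :: nat \<Rightarrow> 'k mvpoly. g 0 = f \<and> (\<forall>i<n. g i \<in> carrier (mvpoly_ring n)) \<and>
      k_subalgebra (mvpoly_ring n) mvconst (g ` {..<n}) = carrier (mvpoly_ring n))"

lemma mvvars_uminus: "mvvars (- p) = mvvars p"
  by (simp add: mvvars_def)

lemma mvvars_add: "mvvars (p + q) \<subseteq> mvvars p \<union> mvvars q"
  using Poly_Mapping.keys_add[of p q] by (auto simp: mvvars_def)

lemma mvvars_mult: "mvvars (p * q) \<subseteq> mvvars p \<union> mvvars q"
proof
  fix i assume "i \<in> mvvars (p * q)"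
  then obtain m where m: "m \<in> Poly_Mapping.keys (p * q)" "i \<in> Poly_Mapping.keys m"
    by (auto simp: mvvars_def)
  then obtain a b where "m = a + b" "a \<in> Poly_Mapping.keys p" "b \<in> Poly_Mapping.keys q"
    using Poly_Mapping.keys_mult[of p q] by blast
  then show "i \<in> mvvars p \<union> mvvars q"
    using m(2) Poly_Mapping.keys_add[of a b] by (auto simp: mvvars_def)
qed

lemma mvvars_const [simp]: "mvvars (mvconst c) = {}"
  by (simp add: mvvars_def mvconst_def)

lemma mvpoly_ring_simps [simp]:
  "p \<in> carrier (mvpoly_ring n) \<longleftrightarrow> mvvars p \<subseteq> {..<n}"
  "mult (mvpoly_ring n) = (*)" "one (mvpoly_ring n) = 1"
  "zero (mvpoly_ring n) = 0" "add (mvpoly_ring n) = (+)"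
  by (simp_all add: mvpoly_ring_def)

lemma cring_mvpoly_ring: "cring (mvpoly_ring n :: 'k::field mvpoly ring)"
proof (rule cringI)
  show "abelian_group (mvpoly_ring n :: 'k mvpoly ring)"
  proof (rule abelian_groupI)
    fix x :: "'k mvpoly" assume x: "x \<in> carrier (mvpoly_ring n)"
    show "\<exists>y\<in>carrier (mvpoly_ring n). y \<oplus>\<^bsub>mvpoly_ring n\<^esub> x = \<zero>\<^bsub>mvpoly_ring n\<^esub>"
      using x by (intro bexI[of _ "- x"]) (auto simp: mvvars_uminus)
  next
    fix x y :: "'k mvpoly"
    assume "x \<in> carrier (mvpoly_ring n)" "y \<in> carrier (mvpoly_ring n)"
    then show "x \<oplus>\<^bsub>mvpoly_ring n\<^esub> y \<in> carrier (mvpoly_ring n)"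
      using mvvars_add[of x y] by auto
  qed (simp_all add: mvvars_def add.assoc add.commute)
  show "comm_monoid (mvpoly_ring n :: 'k mvpoly ring)"
  proof (rule comm_monoidI)
    fix x y :: "'k mvpoly"
    assume "x \<in> carrier (mvpoly_ring n)" "y \<in> carrier (mvpoly_ring n)"
    then show "x \<otimes>\<^bsub>mvpoly_ring n\<^esub> y \<in> carrier (mvpoly_ring n)"
      using mvvars_mult[of x y] by auto
  qed (simp_all add: mvvars_def mult.assoc mult.commute)
qed (simp add: distrib_right)

lemma (in ring) induced_map_coset:
  assumes I: "ideal I R" and D: "D \<in> carrier R \<rightarrow> carrier R"
    and add: "\<And>a b. a \<in> carrier R \<Longrightarrow> b \<in> carrier R \<Longrightarrow> D (a \<oplus> b) = D a \<oplus> D b"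
    and DI: "\<And>a. a \<in> I \<Longrightarrow> D a \<in> I" and a: "a \<in> carrier R"
  shows "induced_map R I D (I +> a) = I +> D a"
proof -
  interpret I: ideal I R by (rule I)
  have Da: "D a \<in> carrier R" using D a by blast
  have eq: "I +> D b = I +> D a" if b: "b \<in> I +> a" for b
  proof -
    obtain j where j: "j \<in> I" "b = j \<oplus> a"
      using b unfolding a_r_coset_def' by blast
    have "D b = D j \<oplus> D a"
      unfolding j(2) by (rule add[OF I.a_Hcarr[OF j(1)] a])
    then have "D b \<in> I +> D a"
      using DI[OF j(1)] unfolding a_r_coset_def' by blast
    then show ?thesis
      by (rule I.a_repr_independence'[OF _ Da, symmetric])
  qed
  have "a \<in> I +> a" using a by (rule I.a_rcos_self)
  with eq show ?thesis unfolding induced_map_def by blast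
qed

end

(*
  If f = g_0, g_1, ..., g_(n-1) generate A, then by the chain rule their Jacobian matrix is invertible,
  and the derivations dual to g_1, ..., g_(n-1) are the required ones.

  Conversely, let D_1, ..., D_(n-1) be as in MSC(n).  Independence modulo f - alpha implies independence
  over A, because no nonzero element is divisible by all powers of f - alpha, and independence is
  inherited by the restrictions to the kernels of some of the D_j.  Hence D_i does not vanish on the
  common kernel of the other D_j, and it has a local slice there: an element a with D_i a = P(f) nonzero
  and D_j a = 0 for j other than i.  On each fibre the common kernel of the induced derivations is k.
  So if alpha is a root of P, then a is a constant plus (f - alpha) b for some b, and replacing a by b
  cancels this root.  In the end D_i s_i = 1, and subtracting leading terms
  s_i^j D_i^j(a)/j! shows A = k[f, s_1, ..., s_(n-1)].
*)

theory Submission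
  imports Defs
begin

section \<open>Locally nilpotent derivations of subdomains\<close>

text \<open>All computation stays in one type, the polynomials in countably many variables, which is
  a domain. \<open>subdomain\<close> treats \<open>k^{[n]}\<close> and the kernels of derivations
  alike as subsets of it, so a statement about derivations applies again to their restrictions.
  Localising at \<open>D s\<close> would leave this type; target sets are therefore closed under
  cancelling \<open>fact j * D s ^ j\<close>.

  The isomorphism of a fibre with \<open>k^{[n-1]}\<close> has two uses. It makes f - \<alpha> a
  nonzero nonunit, so that its powers cannot divide a nonzero element indefinitely. It also supplies
  n-1 partial derivatives: the n-1 induced derivations have a square coefficient matrix over them,
  and independence forces an element killed by all of them to be killed by every partial derivative.

  The roots of P are not under control, so the fibre argument must be available at every \<alpha>,
  and k is algebraically closed so that P has a root as long as its degree is positive.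
  Characteristic zero enters through the factorials and because vanishing partial derivatives leave
  only constants.\<close>

locale subdomain =
  fixes A :: "'a::{idom,ring_char_0} set"
  assumes one_mem [simp, intro]: "1 \<in> A"
    and minus_mem [intro]: "a \<in> A \<Longrightarrow> b \<in> A \<Longrightarrow> a - b \<in> A"
    and mult_mem [intro]: "a \<in> A \<Longrightarrow> b \<in> A \<Longrightarrow> a * b \<in> A"
begin

lemma zero_mem [simp, intro]: "0 \<in> A"
  using minus_mem[of 1 1] by simp

lemma uminus_mem [intro]: "a \<in> A \<Longrightarrow> - a \<in> A"
  using minus_mem[of 0 a] by simp

lemma add_mem [intro]: "a \<in> A \<Longrightarrow> b \<in> A \<Longrightarrow> a + b \<in> A"
  using minus_mem[of a "- b"] uminus_mem[of b] by simp

lemma of_nat_mem [simp, intro]: "of_nat j \<in> A"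
  by (induction j) auto

lemma fact_mem [simp, intro]: "fact j \<in> A"
  by (metis of_nat_fact of_nat_mem)

lemma power_mem [intro]: "a \<in> A \<Longrightarrow> a ^ j \<in> A"
  by (induction j) auto

lemma sum_mem [intro]: "(\<And>i. i \<in> I \<Longrightarrow> u i \<in> A) \<Longrightarrow> sum u I \<in> A"
  by (induction I rule: infinite_finite_induct) auto

section \<open>Linear algebra over a domain, without its quotient field\<close>

text \<open>Fraction-free Gaussian elimination: with the pivot \<open>M k j\<close>, the entries
  \<open>M i l\<close> become \<open>M k j * M i l - M i j * M k l\<close>, which again lie in
  \<open>A\<close>, and one equation and one unknown disappear.\<close>

lemma underdetermined_system:
  assumes "finite J" "finite I" "card J < card I"
    and "\<And>i j. i \<in> I \<Longrightarrow> j \<in> J \<Longrightarrow> M i j \<in> A"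
  shows "\<exists>c. (\<forall>i\<in>I. c i \<in> A) \<and> (\<exists>i\<in>I. c i \<noteq> 0) \<and> (\<forall>j\<in>J. (\<Sum>i\<in>I. c i * M i j) = 0)"
  using assms
proof (induction J arbitrary: I M rule: finite_induct)
  case empty
  then obtain i where "i \<in> I" by (metis card_gt_0_iff card.empty ex_in_conv)
  then show ?case by (intro exI[of _ "\<lambda>_. 1"]) auto
next
  case (insert j J)
  show ?case
  proof (cases "\<forall>i\<in>I. M i j = 0")
    case True
    have "card J < card I" using insert by simp
    from insert.IH[OF insert.prems(1) this, of M] insert.prems(3)
    obtain c where "\<forall>i\<in>I. c i \<in> A" "\<exists>i\<in>I. c i \<noteq> 0" "\<forall>j\<in>J. (\<Sum>i\<in>I. c i * M i j) = 0"
      by auto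
    with True show ?thesis by (intro exI[of _ c]) auto
  next
    case False
    then obtain k where k: "k \<in> I" "M k j \<noteq> 0" by auto
    let ?I = "I - {k}"
    let ?N = "\<lambda>i l. M k j * M i l - M i j * M k l"
    have "card J < card ?I" using insert k by simp
    moreover have "?N i l \<in> A" if "i \<in> ?I" "l \<in> J" for i l
      using that insert.prems(3) k by (intro minus_mem mult_mem) auto
    ultimately obtain c where c: "\<forall>i\<in>?I. c i \<in> A" "\<exists>i\<in>?I. c i \<noteq> 0"
        "\<forall>l\<in>J. (\<Sum>i\<in>?I. c i * ?N i l) = 0"
      using insert.IH[of ?I ?N] insert.prems(1) by auto
    \<comment> \<open>The solution of the reduced system is scaled by the pivot, and the coefficient
      at \<open>k\<close> is then forced by equation \<open>j\<close>.\<close>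
    define d where "d = (\<lambda>i. if i = k then - (\<Sum>i\<in>?I. c i * M i j) else M k j * c i)"
    have split: "(\<Sum>i\<in>I. d i * M i l) =
        (\<Sum>i\<in>?I. M k j * c i * M i l) - (\<Sum>i\<in>?I. c i * M i j) * M k l" for l
      using insert.prems(1) k by (subst sum.remove[of I k]) (auto simp: d_def)
    have "(\<Sum>i\<in>I. d i * M i l) = 0" if "l \<in> insert j J" for l
    proof (cases "l = j")
      case True
      then show ?thesis unfolding split by (simp add: sum_distrib_left mult_ac)
    next
      case False
      then have "(\<Sum>i\<in>?I. c i * ?N i l) = 0" using that c(3) by auto
      then show ?thesis unfolding split
        by (simp add: sum_distrib_left sum_subtractf right_diff_distrib mult_ac)
    qed
    moreover have "\<forall>i\<in>I. d i \<in> A"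
      using c(1) insert.prems(3) k unfolding d_def by (auto intro!: uminus_mem sum_mem mult_mem)
    moreover have "\<exists>i\<in>I. d i \<noteq> 0" using c(2) k by (auto simp: d_def)
    ultimately show ?thesis by blast
  qed
qed

text \<open>Without column \<open>k\<close> there are fewer equations than unknowns, so some nonzero
  row \<open>c\<close> makes \<open>c M\<close> vanish outside \<open>k\<close>. Pairing
  \<open>c M\<close> with \<open>w\<close> gives \<open>(c M)_k * w k = 0\<close>, and
  \<open>w k\<close> cancels.\<close>

lemma left_kernel_from_right_kernel:
  assumes I: "finite I" and M: "\<And>i j. i \<in> I \<Longrightarrow> j \<in> I \<Longrightarrow> M i j \<in> A"
    and w: "\<And>i. i \<in> I \<Longrightarrow> (\<Sum>j\<in>I. M i j * w j) = 0" and k: "k \<in> I" "w k \<noteq> 0"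
  obtains c where "\<And>i. i \<in> I \<Longrightarrow> c i \<in> A" "\<exists>i\<in>I. c i \<noteq> 0"
    "\<And>j. j \<in> I \<Longrightarrow> (\<Sum>i\<in>I. c i * M i j) = 0"
proof -
  have "card (I - {k}) < card I" using I k by (intro card_Diff1_less)
  from underdetermined_system[OF _ I this, of M] I M obtain c where
    c: "\<forall>i\<in>I. c i \<in> A" "\<exists>i\<in>I. c i \<noteq> 0" "\<forall>j\<in>I-{k}. (\<Sum>i\<in>I. c i * M i j) = 0"
    by auto
  have "0 = (\<Sum>i\<in>I. c i * (\<Sum>j\<in>I. M i j * w j))" using w by simp
  also have "\<dots> = (\<Sum>j\<in>I. (\<Sum>i\<in>I. c i * M i j) * w j)"
    unfolding sum_distrib_left sum_distrib_right
    by (subst sum.swap) (simp add: mult.assoc)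
  also have "\<dots> = (\<Sum>i\<in>I. c i * M i k) * w k"
    using I k c(3) by (subst sum.remove[of I k]) auto
  finally have "(\<Sum>i\<in>I. c i * M i k) = 0" using k by simp
  with c show ?thesis by (intro that[of c]) auto
qed

text \<open>From \<open>H J = 1\<close> follows \<open>(J H - 1) J = 0\<close>. A nonzero row of
  \<open>J H - 1\<close> is a right kernel vector of the transpose of \<open>J\<close>, so there is
  also a nonzero \<open>c\<close> with \<open>J c = 0\<close>, against
  \<open>c = H J c\<close>.\<close>

lemma right_inverse_from_left_inverse:
  assumes I: "finite I" and J: "\<And>i j. i \<in> I \<Longrightarrow> j \<in> I \<Longrightarrow> J i j \<in> A"
    and HJ: "\<And>i j. i \<in> I \<Longrightarrow> j \<in> I \<Longrightarrow> (\<Sum>l\<in>I. H i l * J l j) = (if i = j then 1 else 0)"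
    and ij: "i \<in> I" "j \<in> I"
  shows "(\<Sum>l\<in>I. J i l * H l j) = (if i = j then 1 else 0)"
proof (rule ccontr)
  assume ne: "\<not> ?thesis"
  define v where "v = (\<lambda>j. (\<Sum>l\<in>I. J i l * H l j) - (if i = j then 1 else 0))"
  have "(\<Sum>j\<in>I. J j k * v j) = 0" if k: "k \<in> I" for k
  proof -
    have "(\<Sum>j\<in>I. J j k * (\<Sum>l\<in>I. J i l * H l j)) = (\<Sum>l\<in>I. J i l * (\<Sum>j\<in>I. H l j * J j k))"
      unfolding sum_distrib_left by (subst sum.swap) (simp add: mult_ac)
    also have "\<dots> = (\<Sum>l\<in>I. J i l * (if l = k then 1 else 0))"
      by (intro sum.cong refl) (simp add: HJ k)
    also have "\<dots> = J i k" using I k by (simp add: if_distrib[of "(*) _"] cong: if_cong)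
    finally show ?thesis using I ij(1)
      by (simp add: v_def right_diff_distrib sum_subtractf if_distrib[of "(*) _"] cong: if_cong)
  qed
  note v = this
  have vj: "v j \<noteq> 0" using ne by (simp add: v_def)
  obtain c where c: "\<exists>i\<in>I. c i \<noteq> 0" "\<And>j. j \<in> I \<Longrightarrow> (\<Sum>i\<in>I. c i * J j i) = 0"
    by (rule left_kernel_from_right_kernel[OF I, of "\<lambda>k j. J j k" v j]) (use J ij v vj in auto)
  have "c k = 0" if k: "k \<in> I" for k
  proof -
    have "c k = (\<Sum>i\<in>I. (if k = i then 1 else 0) * c i)"
      using I k by (simp add: if_distrib[of "\<lambda>x. x * _"] cong: if_cong)
    also have "\<dots> = (\<Sum>i\<in>I. (\<Sum>l\<in>I. H k l * J l i) * c i)"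
      by (intro sum.cong refl) (simp add: HJ k)
    also have "\<dots> = (\<Sum>l\<in>I. H k l * (\<Sum>i\<in>I. c i * J l i))"
      unfolding sum_distrib_left sum_distrib_right by (subst sum.swap) (simp add: mult_ac)
    also have "\<dots> = 0" using c(2) by simp
    finally show ?thesis .
  qed
  with c(1) show False by blast
qed

end

section \<open>Derivations, local slices and induction along a local slice\<close>

text \<open>A subdomain carries no distinguished coefficient field, so vanishing on constants is
  stated separately; see \<open>k_derivation_mvpoly_iff\<close>.\<close>

definition derivation_on :: "'a::comm_ring_1 set \<Rightarrow> ('a \<Rightarrow> 'a) \<Rightarrow> bool"
  where "derivation_on A D \<longleftrightarrow> D \<in> A \<rightarrow> A \<and>
    (\<forall>a\<in>A. \<forall>b\<in>A. D (a + b) = D a + D b) \<and> (\<forall>a\<in>A. \<forall>b\<in>A. D (a * b) = a * D b + D a * b)"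

definition nilpotent_on :: "'a::zero set \<Rightarrow> ('a \<Rightarrow> 'a) \<Rightarrow> bool"
  where "nilpotent_on A D \<longleftrightarrow> (\<forall>a\<in>A. \<exists>j. (D ^^ j) a = 0)"

context subdomain
begin

context
  fixes D assumes D: "derivation_on A D"
begin

lemma derivation_mem: "a \<in> A \<Longrightarrow> D a \<in> A"
  using D by (auto simp: derivation_on_def)

lemma derivation_add: "a \<in> A \<Longrightarrow> b \<in> A \<Longrightarrow> D (a + b) = D a + D b"
  using D by (auto simp: derivation_on_def)

lemma derivation_mult: "a \<in> A \<Longrightarrow> b \<in> A \<Longrightarrow> D (a * b) = a * D b + D a * b"
  using D by (auto simp: derivation_on_def)

lemma derivation_zero: "D 0 = 0"
  using derivation_add[of 0 0] by simp

lemma derivation_one: "D 1 = 0"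
  using derivation_mult[of 1 1] by simp

lemma derivation_uminus: "a \<in> A \<Longrightarrow> D (- a) = - D a"
  using derivation_add[of a "- a"]
  by (simp add: uminus_mem eq_neg_iff_add_eq_0 add.commute derivation_zero)

lemma derivation_minus: "a \<in> A \<Longrightarrow> b \<in> A \<Longrightarrow> D (a - b) = D a - D b"
  using derivation_add[of a "- b"] by (simp add: uminus_mem derivation_uminus)

lemma derivation_of_nat: "D (of_nat j) = 0"
  by (induction j) (simp_all add: derivation_add derivation_zero derivation_one)

lemma derivation_fact: "D (fact j) = 0"
  by (metis of_nat_fact derivation_of_nat)

lemma derivation_power: "a \<in> A \<Longrightarrow> D (a ^ Suc j) = of_nat (Suc j) * a ^ j * D a"
  by (induction j) (simp_all add: derivation_mult derivation_one power_mem mult_mem algebra_simps)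

lemma derivation_iterate_mem: "a \<in> A \<Longrightarrow> (D ^^ j) a \<in> A"
  by (induction j) (auto intro: derivation_mem)

lemma derivation_iterate_minus:
  "a \<in> A \<Longrightarrow> b \<in> A \<Longrightarrow> (D ^^ j) (a - b) = (D ^^ j) a - (D ^^ j) b"
  by (induction j) (simp_all add: derivation_minus derivation_iterate_mem)

lemma derivation_constant_mult:
  "a \<in> A \<Longrightarrow> b \<in> A \<Longrightarrow> D a = 0 \<Longrightarrow> D (a * b) = a * D b"
  by (simp add: derivation_mult)

lemma derivation_iterate_constant_mult:
  "a \<in> A \<Longrightarrow> b \<in> A \<Longrightarrow> D a = 0 \<Longrightarrow> (D ^^ j) (a * b) = a * (D ^^ j) b"
  by (induction j) (simp_all add: derivation_constant_mult derivation_iterate_mem)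

text \<open>The local slice is \<open>(D ^^ j) a\<close>: its image under \<open>D\<close> is the
  last nonzero iterate of \<open>a\<close>. Since \<open>a\<close> and \<open>D a\<close> are both
  nonzero, the first vanishing iterate has index at least 2.\<close>

lemma local_slice_exists:
  assumes nil: "nilpotent_on A D" and a: "a \<in> A" "D a \<noteq> 0"
  obtains j where "(D ^^ Suc j) a \<noteq> 0" "(D ^^ Suc (Suc j)) a = 0"
proof -
  define k where "k = (LEAST k. (D ^^ k) a = 0)"
  have k: "(D ^^ k) a = 0"
    unfolding k_def using nil a(1) by (auto simp: nilpotent_on_def intro: LeastI_ex)
  have lt: "(D ^^ j) a \<noteq> 0" if "j < k" for j
    using not_less_Least that unfolding k_def by blast
  have "k \<noteq> 0" using k a(2) by (intro notI) (simp add: derivation_zero)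
  moreover have "k \<noteq> 1" using k a(2) by (intro notI) (simp add: derivation_zero)
  ultimately obtain j where "k = Suc (Suc j)" by (metis One_nat_def not0_implies_Suc)
  with k lt[of "Suc j"] show ?thesis by (intro that[of j]) auto
qed

text \<open>Each application of \<open>D\<close> lowers the exponent of \<open>s\<close> and
  produces a factor killed by \<open>D\<close>. The factor is absorbed into \<open>b\<close>, which
  is why \<open>b\<close> varies in the induction.\<close>

lemma iterate_slice_power:
  assumes s: "s \<in> A" "D (D s) = 0" and b: "b \<in> A" "D b = 0"
  shows "(D ^^ j) (s ^ j * b) = fact j * D s ^ j * b"
  using b
proof (induction j arbitrary: b)
  case (Suc j)
  let ?b = "of_nat (Suc j) * (D s * b)"
  have Ds: "D s \<in> A" using s by (auto intro: derivation_mem)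
  have "D (s ^ Suc j * b) = s ^ j * ?b"
    by (subst derivation_mult)
      (use s Suc.prems in \<open>simp_all add: derivation_power power_mem mult_ac del: power_Suc of_nat_Suc\<close>)
  then have "(D ^^ Suc j) (s ^ Suc j * b) = (D ^^ j) (s ^ j * ?b)"
    by (simp only: funpow_Suc_right o_apply)
  also have "\<dots> = fact j * D s ^ j * ?b"
    using s Ds Suc.prems by (intro Suc.IH) (simp_all add: mult_mem derivation_mult derivation_of_nat del: of_nat_Suc)
  finally show ?case by (simp add: algebra_simps)
qed simp

text \<open>
  Subtracting the leading term \<open>s\<^sup>j D\<^sup>j a / (j! (D s)\<^sup>j)\<close> lowers the order of nilpotency of \<open>a\<close>.
\<close>

lemma local_slice_induction:
  assumes nil: "nilpotent_on A D" and s: "s \<in> A" "D (D s) = 0"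
    and T: "s \<in> T" "\<And>a. a \<in> A \<Longrightarrow> D a = 0 \<Longrightarrow> a \<in> T"
      "\<And>a b. a \<in> A \<Longrightarrow> b \<in> A \<Longrightarrow> a \<in> T \<Longrightarrow> b \<in> T \<Longrightarrow> a + b \<in> T"
      "\<And>a b. a \<in> A \<Longrightarrow> b \<in> A \<Longrightarrow> a \<in> T \<Longrightarrow> b \<in> T \<Longrightarrow> a * b \<in> T"
      "\<And>j a. a \<in> A \<Longrightarrow> fact j * D s ^ j * a \<in> T \<Longrightarrow> a \<in> T"
  shows "A \<subseteq> T"
proof
  fix a assume "a \<in> A"
  moreover obtain k where "(D ^^ k) a = 0" using nil calculation by (auto simp: nilpotent_on_def)
  ultimately show "a \<in> T"
  proof (induction k arbitrary: a)
    case 0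
    then show ?case using T(2)[of a] by (simp add: derivation_zero)
  next
    case (Suc j)
    let ?b = "(D ^^ j) a" and ?c = "fact j * D s ^ j"
    have Ds: "D s \<in> A" using s by (auto intro: derivation_mem)
    have b: "?b \<in> A" "D ?b = 0" using Suc.prems by (auto simp: derivation_iterate_mem)
    have c: "?c \<in> A" using Ds by (intro mult_mem power_mem) auto
    have Dpow: "D (D s ^ j) = 0"
      using Ds s by (cases j) (simp_all add: derivation_power derivation_one del: power_Suc)
    have Dc: "D ?c = 0" using Ds Dpow by (simp add: derivation_mult derivation_fact power_mem)
    have sp: "s ^ i \<in> T" for i
    proof (induction i)
      case 0 then show ?case using T(2)[of 1] by (simp add: derivation_one)
    next
      case (Suc i) then show ?case using T(1,4) s by (simp add: power_mem)
    qed
    have t: "s ^ j * ?b \<in> A" "s ^ j * ?b \<in> T"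
      using s b T(4)[OF power_mem[OF s(1)] b(1) sp T(2)[OF b]] by (auto intro: mult_mem power_mem)
    have ca: "?c * a \<in> A" using c Suc.prems by auto
    \<comment> \<open>Both terms are sent to \<open>fact j * D s ^ j * (D ^^ j) a\<close>, since
      \<open>D\<close> kills \<open>?c\<close> and \<open>?b\<close>. Multiplying \<open>a\<close>
      by \<open>?c\<close> replaces dividing the leading term by it.\<close>
    have "(D ^^ j) (?c * a - s ^ j * ?b) = 0"
      using Suc.prems c Dc ca t s b
      by (simp add: derivation_iterate_minus derivation_iterate_constant_mult iterate_slice_power)
    then have "?c * a - s ^ j * ?b \<in> T"
      using ca t by (intro Suc.IH) auto
    from T(3)[OF _ t(1) this t(2)] have "?c * a \<in> T" using ca t by auto
    then show ?case using T(5) Suc.prems by blast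
  qed
qed

end

end

section \<open>Commuting locally nilpotent derivations and their joint kernels\<close>

locale commuting_lnds = subdomain A for A :: "'a::{idom,ring_char_0} set" +
  fixes I :: "'i set" and D :: "'i \<Rightarrow> 'a \<Rightarrow> 'a"
  assumes fin: "finite I"
    and der: "\<And>i. i \<in> I \<Longrightarrow> derivation_on A (D i)"
    and nil: "\<And>i. i \<in> I \<Longrightarrow> nilpotent_on A (D i)"
    and comm: "\<And>i j a. i \<in> I \<Longrightarrow> j \<in> I \<Longrightarrow> a \<in> A \<Longrightarrow> D i (D j a) = D j (D i a)"
begin

definition joint_ker :: "'i set \<Rightarrow> 'a set"
  where "joint_ker S = {a \<in> A. \<forall>i\<in>S. D i a = 0}"

lemma joint_ker_mem: "a \<in> joint_ker S \<Longrightarrow> a \<in> A"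
  by (simp add: joint_ker_def)

lemma joint_ker_insert: "joint_ker (insert i S) = {a \<in> joint_ker S. D i a = 0}"
  by (auto simp: joint_ker_def)

lemma subdomain_joint_ker: "S \<subseteq> I \<Longrightarrow> subdomain (joint_ker S)"
  using der
  by unfold_locales
    (auto simp: joint_ker_def derivation_one derivation_minus derivation_mult subset_iff)

text \<open>Commutation carries \<open>D i\<close> into the kernels of the other derivations; the
  slice arguments use it only through this restriction.\<close>

lemma derivation_on_joint_ker:
  assumes "S \<subseteq> I" "i \<in> I" shows "derivation_on (joint_ker S) (D i)"
proof -
  have "D i a \<in> joint_ker S" if a: "a \<in> joint_ker S" for a
  proof -
    have "D j (D i a) = 0" if "j \<in> S" for j
    proof -
      have "D j (D i a) = D i (D j a)" using assms a that by (intro comm) (auto simp: joint_ker_def)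
      also have "\<dots> = 0" using a that der[OF assms(2)] by (simp add: joint_ker_def derivation_zero)
      finally show ?thesis .
    qed
    then show ?thesis using a der[OF assms(2)] by (auto simp: joint_ker_def derivation_mem)
  qed
  then show ?thesis
    using der[OF assms(2)] by (auto simp: derivation_on_def joint_ker_def)
qed

lemma nilpotent_on_joint_ker: "i \<in> I \<Longrightarrow> nilpotent_on (joint_ker S) (D i)"
  using nil by (auto simp: nilpotent_on_def joint_ker_def)

lemma local_slice_joint_ker:
  assumes S: "S \<subseteq> I" and i: "i \<in> I" and a: "a \<in> joint_ker S" "D i a \<noteq> 0"
  obtains s where "s \<in> joint_ker S" "D i s \<in> joint_ker (insert i S)" "D i s \<noteq> 0"
proof -
  interpret B: subdomain "joint_ker S" using subdomain_joint_ker[OF S] .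
  note d = derivation_on_joint_ker[OF S i]
  obtain j where "(D i ^^ Suc j) a \<noteq> 0" "(D i ^^ Suc (Suc j)) a = 0"
    using B.local_slice_exists[OF d nilpotent_on_joint_ker[OF i] a] .
  moreover have "(D i ^^ k) a \<in> joint_ker S" for k
    by (rule B.derivation_iterate_mem[OF d a(1)])
  ultimately show ?thesis
    using that[of "(D i ^^ j) a"] B.derivation_mem[OF d] by (auto simp: joint_ker_insert)
qed

text \<open>The derivations are restricted to \<open>joint_ker S\<close>, but the coefficients range
  over all of \<open>A\<close>. In this form the property survives enlarging \<open>S\<close>: the
  new coefficient \<open>E s\<close> in \<open>independent_on_insert\<close> is only known to lie in
  \<open>A\<close>.\<close>

definition independent_on :: "'i set \<Rightarrow> bool"
  where "independent_on S \<longleftrightarrow> (\<forall>c. (\<forall>i\<in>I-S. c i \<in> A) \<longrightarrow>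
    (\<forall>x\<in>joint_ker S. (\<Sum>i\<in>I-S. c i * D i x) = 0) \<longrightarrow> (\<forall>i\<in>I-S. c i = 0))"

lemma independent_on_nonzero:
  assumes "independent_on S" "j \<in> I - S"
  obtains a where "a \<in> joint_ker S" "D j a \<noteq> 0"
proof -
  let ?c = "\<lambda>i. if i = j then 1 else 0"
  have "(\<Sum>i\<in>I-S. ?c i * D i x) = D j x" for x
    using assms(2) fin by (subst sum.remove[of _ j]) auto
  moreover have "?c i \<in> A" for i by auto
  ultimately have "\<not> (\<forall>x\<in>joint_ker S. D j x = 0)"
    using assms(1)[unfolded independent_on_def, rule_format, of ?c j] assms(2)
    by auto
  then show ?thesis using that by blast
qed

text \<open>
  If \<open>E = \<Sum> c\<^sub>i D\<^sub>i\<close> vanishes on the kernel of \<open>D\<^sub>j\<close> and \<open>s\<close> is a local slice of \<open>D\<^sub>j\<close>, then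
  \<open>(D\<^sub>j s) E - (E s) D\<^sub>j\<close> vanishes on that kernel and at \<open>s\<close>, hence everywhere.
\<close>

lemma independent_on_insert:
  assumes S: "S \<subseteq> I" and ind: "independent_on S" and j: "j \<in> I - S"
  shows "independent_on (insert j S)"
  unfolding independent_on_def
proof (intro allI impI)
  fix c
  let ?K = "I - insert j S"
  define E where "E = (\<lambda>x. \<Sum>i\<in>?K. c i * D i x)"
  assume c: "\<forall>i\<in>?K. c i \<in> A"
    and "\<forall>x\<in>joint_ker (insert j S). (\<Sum>i\<in>?K. c i * D i x) = 0"
  then have E0: "E x = 0" if "x \<in> joint_ker S" "D j x = 0" for x
    using that by (simp add: E_def joint_ker_insert)
  interpret B: subdomain "joint_ker S" using subdomain_joint_ker[OF S] .
  have jI: "j \<in> I" using j by simp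
  note dj = derivation_on_joint_ker[OF S jI]
  note nj = nilpotent_on_joint_ker[OF jI, of S]
  obtain a where "a \<in> joint_ker S" "D j a \<noteq> 0" using independent_on_nonzero[OF ind j] .
  then obtain s where s: "s \<in> joint_ker S" "D j s \<in> joint_ker (insert j S)" "D j s \<noteq> 0"
    using local_slice_joint_ker[OF S jI] by blast
  have Eadd: "E (a + b) = E a + E b" if "a \<in> A" "b \<in> A" for a b
    unfolding E_def sum.distrib[symmetric]
    by (intro sum.cong refl) (use that der in \<open>simp add: derivation_add distrib_left\<close>)
  have Emult: "E (a * b) = a * E b + E a * b" if "a \<in> A" "b \<in> A" for a b
    unfolding E_def sum_distrib_left sum_distrib_right sum.distrib[symmetric]
    by (intro sum.cong refl) (use that der in \<open>simp add: derivation_mult algebra_simps\<close>)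
  define p where "p = D j s"
  define T where "T = {a \<in> joint_ker S. p * E a = E s * D j a}"
  have p: "p \<in> joint_ker S" "D j p = 0" "p \<noteq> 0"
    using s by (auto simp: joint_ker_insert p_def)
  have Jmem: "a \<in> A" if "a \<in> joint_ker S" for a using that by (rule joint_ker_mem)
  have "joint_ker S \<subseteq> T"
  proof (rule B.local_slice_induction[OF dj nj s(1)])
    show "D j (D j s) = 0" using p by (simp add: p_def)
    show "s \<in> T" using s by (simp add: T_def p_def mult.commute)
    show "a \<in> T" if "a \<in> joint_ker S" "D j a = 0" for a
      using that E0 by (simp add: T_def)
  next
    fix a b assume ab: "a \<in> joint_ker S" "b \<in> joint_ker S" "a \<in> T" "b \<in> T"
    then have e: "p * E a = E s * D j a" "p * E b = E s * D j b" by (auto simp: T_def)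
    show "a + b \<in> T"
      using ab(1,2) e by (simp add: T_def B.add_mem Eadd Jmem B.derivation_add[OF dj] distrib_left)
    have "p * E (a * b) = a * (p * E b) + (p * E a) * b"
      using ab by (simp add: Emult Jmem algebra_simps)
    then show "a * b \<in> T"
      using ab(1,2) e by (simp add: T_def B.mult_mem B.derivation_mult[OF dj] algebra_simps)
  next
    fix k a assume a: "a \<in> joint_ker S" and aT: "fact k * D j s ^ k * a \<in> T"
    define q where "q = fact k * p ^ k"
    have q: "q \<in> joint_ker S" "q \<noteq> 0"
      using p by (auto simp: q_def intro!: B.mult_mem B.power_mem)
    have Dp: "D j (p ^ k) = 0"
      using p by (cases k) (simp_all add: B.derivation_power[OF dj] B.derivation_one[OF dj] del: power_Suc)
    then have Dq: "D j q = 0"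
      using p by (simp add: q_def B.derivation_mult[OF dj] B.power_mem B.derivation_fact[OF dj])
    from aT have "p * E (q * a) = E s * D j (q * a)"
      by (simp add: T_def q_def p_def)
    \<comment> \<open>\<open>q\<close> lies in the kernel of \<open>D j\<close>, where
      \<open>E\<close> vanishes, so both \<open>E\<close> and \<open>D j\<close> treat it as a
      constant factor, which cancels afterwards.\<close>
    then have "q * (p * E a) = q * (E s * D j a)"
      using q a Dq E0[OF q(1) Dq] by (simp add: Emult Jmem B.derivation_mult[OF dj] algebra_simps)
    then show "a \<in> T" using q a by (simp add: T_def)
  qed
  then have T: "p * E a = E s * D j a" if "a \<in> joint_ker S" for a
    using that by (auto simp: T_def)
  \<comment> \<open>The coefficients of \<open>p E - (E s) D_j\<close> as a combination over
    \<open>I - S\<close>. Independence on \<open>S\<close> makes them vanish, and \<open>p\<close>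
    cancels from \<open>p * c i\<close>.\<close>
  define d where "d = (\<lambda>i. if i = j then - E s else p * c i)"
  have K: "I - S = insert j ?K" using j by auto
  have "E s \<in> A"
    unfolding E_def using c s der by (intro sum_mem mult_mem) (auto intro: derivation_mem Jmem)
  then have "\<forall>i\<in>I-S. d i \<in> A" using c p Jmem by (auto simp: d_def)
  moreover have "(\<Sum>i\<in>I-S. d i * D i x) = 0" if x: "x \<in> joint_ker S" for x
  proof -
    have "(\<Sum>i\<in>I-S. d i * D i x) = d j * D j x + (\<Sum>i\<in>?K. d i * D i x)"
      unfolding K using fin by (subst sum.insert) auto
    also have "(\<Sum>i\<in>?K. d i * D i x) = p * E x"
      unfolding E_def sum_distrib_left by (intro sum.cong refl) (auto simp: d_def mult.assoc)
    finally show ?thesis using T[OF x] by (simp add: d_def)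
  qed
  ultimately have "\<forall>i\<in>I-S. d i = 0"
    using ind unfolding independent_on_def by blast
  then show "\<forall>i\<in>?K. c i = 0" using p by (auto simp: d_def split: if_splits)
qed

lemma independent_on_subset:
  assumes "independent_on {}" "S \<subseteq> I" shows "independent_on S"
proof -
  have "finite S" using assms(2) fin by (rule finite_subset)
  then show ?thesis using assms(2)
  proof (induction S rule: finite_induct)
    case (insert j S)
    then show ?case by (intro independent_on_insert) auto
  qed (rule assms(1))
qed

text \<open>On the kernel of all derivations but \<open>D i\<close>, only \<open>D i\<close> is left
  and it is nonzero by independence. A local slice found there has its image in the kernel of the
  whole family.\<close>

lemma local_slices:
  assumes "independent_on {}" "i \<in> I"
  obtains s where "s \<in> A" "D i s \<in> joint_ker I" "D i s \<noteq> 0" "\<And>j. j \<in> I \<Longrightarrow> j \<noteq> i \<Longrightarrow> D j s = 0"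
proof -
  have ind: "independent_on (I - {i})" by (rule independent_on_subset[OF assms(1)]) simp
  obtain a where a: "a \<in> joint_ker (I - {i})" "D i a \<noteq> 0"
    by (rule independent_on_nonzero[OF ind, of i]) (use assms(2) in auto)
  obtain s where s: "s \<in> joint_ker (I - {i})" "D i s \<in> joint_ker (insert i (I - {i}))" "D i s \<noteq> 0"
    by (rule local_slice_joint_ker[OF _ assms(2) a]) auto
  have "insert i (I - {i}) = I" using assms(2) by auto
  with s show ?thesis by (intro that[of s]) (auto simp: joint_ker_def)
qed

text \<open>For a genuine slice the powers of \<open>D i s\<close> drop out of
  \<open>local_slice_induction\<close>, and only the factorials remain. Cancelling them is a
  hypothesis on \<open>T\<close> because the locale has no coefficient field to divide in.\<close>

lemma slice_induction:
  assumes S: "S \<subseteq> I" and i: "i \<in> I" and s: "s \<in> joint_ker S" "D i s = 1"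
    and ker: "joint_ker (insert i S) \<subseteq> T" and sT: "s \<in> T"
    and T: "\<And>a b. a \<in> T \<Longrightarrow> b \<in> T \<Longrightarrow> a + b \<in> T" "\<And>a b. a \<in> T \<Longrightarrow> b \<in> T \<Longrightarrow> a * b \<in> T"
      "\<And>j a. fact j * a \<in> T \<Longrightarrow> a \<in> T"
  shows "joint_ker S \<subseteq> T"
proof -
  interpret B: subdomain "joint_ker S" using subdomain_joint_ker[OF S] .
  note d = derivation_on_joint_ker[OF S i]
  show ?thesis
  proof (rule B.local_slice_induction[OF d nilpotent_on_joint_ker[OF i] s(1)])
    show "D i (D i s) = 0" using s by (simp add: B.derivation_one[OF d])
    show "a \<in> T" if "a \<in> joint_ker S" "D i a = 0" for a
      using that ker by (auto simp: joint_ker_insert)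
    show "a \<in> T" if "a \<in> joint_ker S" "fact j * D i s ^ j * a \<in> T" for j a
      using that T(3)[of j a] s by simp
  qed (rule sT, (rule T(1,2), assumption+)+)
qed

text \<open>The derivations are dropped one at a time, climbing from \<open>joint_ker I\<close> to
  \<open>A\<close>. When \<open>D i\<close> is dropped, \<open>s i\<close> is a slice of it on the
  kernel of those that remain, since they all kill \<open>s i\<close>.\<close>

lemma slices_generate:
  assumes s: "\<And>i. i \<in> I \<Longrightarrow> s i \<in> A" 
      "\<And>i j. i \<in> I \<Longrightarrow> j \<in> I \<Longrightarrow> D j (s i) = (if i = j then 1 else 0)"
    and ker: "joint_ker I \<subseteq> T" and sT: "\<And>i. i \<in> I \<Longrightarrow> s i \<in> T"
    and T: "\<And>a b. a \<in> T \<Longrightarrow> b \<in> T \<Longrightarrow> a + b \<in> T" "\<And>a b. a \<in> T \<Longrightarrow> b \<in> T \<Longrightarrow> a * b \<in> T"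
      "\<And>j a. fact j * a \<in> T \<Longrightarrow> a \<in> T"
  shows "A \<subseteq> T"
proof -
  have "joint_ker (I - S) \<subseteq> T" if "finite S" "S \<subseteq> I" for S
    using that
  proof (induction S rule: finite_induct)
    case empty
    then show ?case using ker by simp
  next
    case (insert i S)
    have e: "insert i (I - insert i S) = I - S" using insert by auto
    have "joint_ker (insert i (I - insert i S)) \<subseteq> T" unfolding e using insert by simp
    note ker' = this
    have si: "s i \<in> joint_ker (I - insert i S)" "D i (s i) = 1" and i: "i \<in> I"
      using insert.hyps insert.prems s by (auto simp: joint_ker_def)
    show ?case
      by (rule slice_induction[OF Diff_subset i si ker' sT[OF i]])
        ((erule (1) T(1) | erule (1) T(2) | erule T(3))+)
  qed
  from this[of I] fin show ?thesis by (auto simp: joint_ker_def)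
qed

end

section \<open>Polynomials and partial derivatives\<close>

lemma poly_mapping_induct_single_add:
  fixes p :: "'a \<Rightarrow>\<^sub>0 'b::monoid_add"
  assumes "P 0" "\<And>p k v. P p \<Longrightarrow> k \<notin> Poly_Mapping.keys p \<Longrightarrow> v \<noteq> 0 \<Longrightarrow> P (p + Poly_Mapping.single k v)"
  shows "P p"
proof (induction p rule: Poly_Mapping.update_induct)
  case const
  then show ?case by (rule assms(1))
next
  case (update p k v)
  have "Poly_Mapping.update k v p = p + Poly_Mapping.single k v"
    by (rule poly_mapping_eqI)
      (use update in \<open>auto simp: lookup_update lookup_add lookup_single in_keys_iff when_def\<close>)
  then show ?case using assms(2) update by simp
qed

lemma mvconst_0 [simp]: "mvconst 0 = 0"
  and mvconst_1 [simp]: "mvconst 1 = 1"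
  and mvconst_add: "mvconst (a + b) = mvconst a + mvconst b"
  and mvconst_mult: "mvconst (a * b) = mvconst a * mvconst b"
  and mvconst_uminus: "mvconst (- a) = - mvconst a"
  and mvconst_minus: "mvconst (a - b) = mvconst a - mvconst b"
  by (simp_all add: mvconst_def single_add mult_single single_uminus single_diff)

lemma mvconst_of_nat: "mvconst (of_nat j) = of_nat j"
  by (simp add: mvconst_def)

lemma mvconst_eq_0_iff [simp]: "mvconst c = 0 \<longleftrightarrow> c = 0"
  by (metis mvconst_def mvconst_0 inj_single[THEN injD])

lemma mvconst_inverse_mult: "c \<noteq> 0 \<Longrightarrow> mvconst (inverse c) * (mvconst c * a) = a"
  by (simp add: mult.assoc[symmetric] mvconst_mult[symmetric])

section \<open>Variables and partial derivatives\<close>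

definition mvX :: "nat \<Rightarrow> 'k::field mvpoly"
  where "mvX i = Poly_Mapping.single (Poly_Mapping.single i 1) 1"

lemma mvvars_mvX [simp]: "mvvars (mvX i) = {i}"
  by (simp add: mvvars_def mvX_def)

text \<open>The monomial \<open>t\<close> receives \<open>t_l + 1\<close> times the coefficient of
  \<open>t + e_l\<close>. Pulling the keys back along the injective shift by \<open>e_l\<close> also
  discards the monomials without \<open>x_l\<close>.\<close>

definition mvpartial :: "nat \<Rightarrow> 'k::field mvpoly \<Rightarrow> 'k mvpoly"
  where "mvpartial l p = Poly_Mapping.mapp (\<lambda>t c. of_nat (Suc (Poly_Mapping.lookup t l)) * c)
    (Poly_Mapping.map_key (\<lambda>t. t + Poly_Mapping.single l 1) p)"

lemma lookup_mvpartial: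
  "Poly_Mapping.lookup (mvpartial l p) t =
    of_nat (Suc (Poly_Mapping.lookup t l)) * Poly_Mapping.lookup p (t + Poly_Mapping.single l 1)"
proof -
  have "inj (\<lambda>t::nat \<Rightarrow>\<^sub>0 nat. t + Poly_Mapping.single l 1)" by (rule injI) simp
  then show ?thesis
    by (simp add: mvpartial_def lookup_mapp map_key.rep_eq when_def in_keys_iff del: of_nat_Suc)
qed

lemma mvpartial_add: "mvpartial l (p + q) = mvpartial l p + mvpartial l q"
  by (rule poly_mapping_eqI) (simp add: lookup_mvpartial lookup_add algebra_simps del: of_nat_Suc)

lemma mvpartial_0 [simp]: "mvpartial l 0 = 0"
  by (rule poly_mapping_eqI) (simp add: lookup_mvpartial del: of_nat_Suc)

text \<open>Subtraction of exponents is truncated. If \<open>x_l\<close> does not occur in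
  \<open>t\<close>, the exponent on the right is wrong but its coefficient is zero.\<close>

lemma mvpartial_single:
  "mvpartial l (Poly_Mapping.single t c) =
    Poly_Mapping.single (t - Poly_Mapping.single l 1) (of_nat (Poly_Mapping.lookup t l) * c)"
proof (rule poly_mapping_eqI)
  fix u
  let ?e = "Poly_Mapping.single l (1::nat)"
  show "Poly_Mapping.lookup (mvpartial l (Poly_Mapping.single t c)) u =
    Poly_Mapping.lookup (Poly_Mapping.single (t - ?e) (of_nat (Poly_Mapping.lookup t l) * c)) u"
  proof (cases "Poly_Mapping.lookup t l = 0")
    case True
    then have "t \<noteq> u + ?e" by (metis add_is_0 lookup_add lookup_single_eq zero_neq_one)
    then show ?thesis using True by (simp add: lookup_mvpartial lookup_single del: of_nat_Suc)
  next
    case False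
    then have e: "t - ?e + ?e = t"
      by (intro poly_mapping_eqI) (auto simp: lookup_add lookup_minus lookup_single when_def)
    have "t = u + ?e \<longleftrightarrow> t - ?e = u" using e by auto
    moreover have "Poly_Mapping.lookup t l = Suc (Poly_Mapping.lookup u l)" if "t = u + ?e"
      using that by (simp add: lookup_add)
    ultimately show ?thesis by (auto simp: lookup_mvpartial lookup_single when_def)
  qed
qed

lemma mvpartial_mult_single:
  "mvpartial l (Poly_Mapping.single s a * Poly_Mapping.single t b) =
    Poly_Mapping.single s a * mvpartial l (Poly_Mapping.single t b) +
    mvpartial l (Poly_Mapping.single s a) * Poly_Mapping.single t b"
proof -
  let ?e = "Poly_Mapping.single l (1::nat)"
  \<comment> \<open>The two ways of lowering the exponent differ at most when \<open>x_l\<close> is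
    absent from \<open>t\<close>, and then both coefficients vanish.\<close>
  have *: "Poly_Mapping.single (s + t - ?e) (of_nat (Poly_Mapping.lookup t l) * c) =
      Poly_Mapping.single (s + (t - ?e)) (of_nat (Poly_Mapping.lookup t l) * (c::'a))" for s t c
  proof (cases "Poly_Mapping.lookup t l = 0")
    case False
    then have "s + t - ?e = s + (t - ?e)"
      by (intro poly_mapping_eqI) (auto simp: lookup_add lookup_minus lookup_single when_def)
    then show ?thesis by simp
  qed simp
  show ?thesis
    using *[of s t "a * b"] *[of t s "a * b"]
    by (simp add: mult_single mvpartial_single lookup_add distrib_left distrib_right single_add add.commute mult_ac)
qed

lemma mvpartial_mult: "mvpartial l (p * q) = p * mvpartial l q + mvpartial l p * q"
proof (induction p rule: poly_mapping_induct_single_add)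
  case (2 p s a)
  have "mvpartial l (Poly_Mapping.single s a * q) =
      Poly_Mapping.single s a * mvpartial l q + mvpartial l (Poly_Mapping.single s a) * q"
    by (induction q rule: poly_mapping_induct_single_add)
      (simp_all add: distrib_left mvpartial_add mvpartial_mult_single)
  with 2 show ?case by (simp add: distrib_right mvpartial_add)
qed simp

lemma mvpartial_mvconst [simp]: "mvpartial l (mvconst c) = 0"
  by (simp add: mvconst_def mvpartial_single)

lemma mvpartial_mvX: "mvpartial l (mvX i) = (if i = l then 1 else 0)"
  by (auto simp: mvX_def mvpartial_single lookup_single when_def single_one[symmetric] simp del: single_one)

lemma mvvars_mvpartial: "mvvars (mvpartial l p) \<subseteq> mvvars p"
proof
  fix i assume "i \<in> mvvars (mvpartial l p)"
  then obtain t where t: "t \<in> Poly_Mapping.keys (mvpartial l p)" "i \<in> Poly_Mapping.keys t"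
    by (auto simp: mvvars_def)
  then have "t + Poly_Mapping.single l 1 \<in> Poly_Mapping.keys p"
    by (auto simp: in_keys_iff lookup_mvpartial simp del: of_nat_Suc)
  moreover have "i \<in> Poly_Mapping.keys (t + Poly_Mapping.single l 1)"
    using t(2) by (auto simp: in_keys_iff lookup_add)
  ultimately show "i \<in> mvvars p" by (auto simp: mvvars_def)
qed

text \<open>A monomial \<open>t\<close> containing \<open>x_l\<close> contributes its coefficient
  times \<open>t_l\<close> to the l-th partial derivative, and \<open>t_l\<close> is nonzero in
  characteristic zero.\<close>

lemma mvconst_if_mvpartial_0:
  fixes a :: "'k::{field,ring_char_0} mvpoly"
  assumes a: "mvvars a \<subseteq> {..<n}" and "\<And>l. l < n \<Longrightarrow> mvpartial l a = 0"
  shows "\<exists>c. a = mvconst c"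
proof (intro exI poly_mapping_eqI)
  fix t :: "nat \<Rightarrow>\<^sub>0 nat"
  show "Poly_Mapping.lookup a t = Poly_Mapping.lookup (mvconst (Poly_Mapping.lookup a 0)) t"
  proof (cases "t = 0")
    case False
    then obtain l where l: "Poly_Mapping.lookup t l \<noteq> 0"
      by (metis lookup_zero poly_mapping_eqI)
    have "Poly_Mapping.lookup a t = 0"
    proof (rule ccontr)
      assume at: "Poly_Mapping.lookup a t \<noteq> 0"
      then have "l \<in> mvvars a" using l unfolding mvvars_def by (auto simp: in_keys_iff)
      then have "l < n" using a by auto
      moreover have "t - Poly_Mapping.single l 1 + Poly_Mapping.single l 1 = t"
        using l by (intro poly_mapping_eqI) (auto simp: lookup_add lookup_minus lookup_single when_def)
      ultimately have "of_nat (Suc (Poly_Mapping.lookup (t - Poly_Mapping.single l 1) l)) *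
          Poly_Mapping.lookup a t = 0"
        using assms(2)[of l] lookup_mvpartial[of l a "t - Poly_Mapping.single l 1"] by simp
      with at show False by (simp del: of_nat_Suc)
    qed
    with False show ?thesis by (simp add: mvconst_def lookup_single)
  qed (simp add: mvconst_def)
qed

lemma mvpoly_induct [consumes 1, case_names const var add mult]:
  assumes "mvvars a \<subseteq> {..<n}"
    and const: "\<And>c. P (mvconst c)" and var: "\<And>i. i < n \<Longrightarrow> P (mvX i)"
    and add: "\<And>a b. mvvars a \<subseteq> {..<n} \<Longrightarrow> mvvars b \<subseteq> {..<n} \<Longrightarrow> P a \<Longrightarrow> P b \<Longrightarrow> P (a + b)"
    and mult: "\<And>a b. mvvars a \<subseteq> {..<n} \<Longrightarrow> mvvars b \<subseteq> {..<n} \<Longrightarrow> P a \<Longrightarrow> P b \<Longrightarrow> P (a * b)"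
  shows "P a"
proof -
  have pow: "P (Poly_Mapping.single (Poly_Mapping.single i k) 1)" if "i < n" for i k
  proof (induction k)
    case 0
    then show ?case using const[of 1] by simp
  next
    case (Suc k)
    have e: "Poly_Mapping.single (Poly_Mapping.single i (Suc k)) 1 =
        mvX i * (Poly_Mapping.single (Poly_Mapping.single i k) 1 :: 'a mvpoly)"
      by (simp add: mvX_def mult_single single_add[symmetric])
    have "mvvars (Poly_Mapping.single (Poly_Mapping.single i k) (1::'a)) \<subseteq> {..<n}"
      using that by (simp add: mvvars_def)
    then show ?case unfolding e using that by (intro mult var Suc) simp_all
  qed
  have mono: "P (Poly_Mapping.single t c)" if "Poly_Mapping.keys t \<subseteq> {..<n}" for t c
    using that
  proof (induction t rule: poly_mapping_induct_single_add)
    case 1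
    then show ?case using const[of c] by (simp add: mvconst_def)
  next
    case (2 t i k)
    have "Poly_Mapping.keys (t + Poly_Mapping.single i k) = insert i (Poly_Mapping.keys t)"
      using 2 by (auto simp: in_keys_iff lookup_add lookup_single when_def split: if_splits)
    then have k: "Poly_Mapping.keys t \<subseteq> {..<n}" "i < n" using 2 by auto
    have e: "Poly_Mapping.single (t + Poly_Mapping.single i k) c =
        Poly_Mapping.single t c * Poly_Mapping.single (Poly_Mapping.single i k) 1"
      by (simp add: mult_single)
    show ?case unfolding e
      using k 2 by (intro mult pow) (auto simp: mvvars_def split: if_splits)
  qed
  show ?thesis using assms(1)
  proof (induction a rule: poly_mapping_induct_single_add)
    case 1
    then show ?case using const[of 0] by simp
  next
    case (2 p t c)
    have "Poly_Mapping.keys (p + Poly_Mapping.single t c) = insert t (Poly_Mapping.keys p)"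
      using 2 by (auto simp: in_keys_iff lookup_add lookup_single when_def split: if_splits)
    then have v: "mvvars p \<subseteq> {..<n}" "Poly_Mapping.keys t \<subseteq> {..<n}"
      using 2 by (auto simp: mvvars_def)
    then show ?case
      using 2 by (intro add mono) (auto simp: mvvars_def split: if_splits)
  qed
qed

section \<open>The ring record \<open>mvpoly_ring n\<close> and its k-subalgebras as subsets of the
  polynomial type\<close>

lemma subdomain_mvpoly: "subdomain (carrier (mvpoly_ring n) :: 'k::field_char_0 mvpoly set)"
proof
  fix a b :: "'k mvpoly"
  assume "a \<in> carrier (mvpoly_ring n)" "b \<in> carrier (mvpoly_ring n)"
  then show "a - b \<in> carrier (mvpoly_ring n)" "a * b \<in> carrier (mvpoly_ring n)"
    using mvvars_add[of a "- b"] mvvars_mult[of a b] by (auto simp: mvvars_uminus)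
qed (simp add: mvvars_def)

lemma derivation_on_mvpartial: "derivation_on (carrier (mvpoly_ring n)) (mvpartial l)"
  using mvvars_mvpartial
  by (fastforce simp: derivation_on_def mvpartial_add mvpartial_mult)

lemma k_derivation_mvpoly_iff:
  "k_derivation (mvpoly_ring n) mvconst D \<longleftrightarrow>
    derivation_on (carrier (mvpoly_ring n)) D \<and> (\<forall>c. D (mvconst c) = 0)"
  by (simp add: k_derivation_def derivation_on_def)

lemma locally_nilpotent_mvpoly_iff:
  "locally_nilpotent (mvpoly_ring n) D \<longleftrightarrow> nilpotent_on (carrier (mvpoly_ring n)) D"
  by (simp add: locally_nilpotent_def nilpotent_on_def)

lemma a_inv_mvpoly:
  assumes "a \<in> carrier (mvpoly_ring n)" shows "\<ominus>\<^bsub>mvpoly_ring n\<^esub> a = - a"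
proof -
  interpret R: cring "mvpoly_ring n" by (rule cring_mvpoly_ring)
  show ?thesis using assms by (intro R.minus_equality) (auto simp: mvvars_uminus)
qed

lemma k_subalgebra_mvpoly:
  assumes "S \<subseteq> carrier (mvpoly_ring n)"
  shows "k_subalgebra (mvpoly_ring n) mvconst S \<subseteq> carrier (mvpoly_ring n)"
    and "mvconst c \<in> k_subalgebra (mvpoly_ring n) mvconst S"
    and "S \<subseteq> k_subalgebra (mvpoly_ring n) mvconst S"
    and "a \<in> k_subalgebra (mvpoly_ring n) mvconst S \<Longrightarrow> b \<in> k_subalgebra (mvpoly_ring n) mvconst S \<Longrightarrow>
      a + b \<in> k_subalgebra (mvpoly_ring n) mvconst S"
    and "a \<in> k_subalgebra (mvpoly_ring n) mvconst S \<Longrightarrow> b \<in> k_subalgebra (mvpoly_ring n) mvconst S \<Longrightarrow>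
      a * b \<in> k_subalgebra (mvpoly_ring n) mvconst S"
proof -
  interpret R: cring "mvpoly_ring n" by (rule cring_mvpoly_ring)
  show "k_subalgebra (mvpoly_ring n) mvconst S \<subseteq> carrier (mvpoly_ring n)"
    unfolding k_subalgebra_def by (rule R.generate_ring_incl) (use assms in auto)
  show "mvconst c \<in> k_subalgebra (mvpoly_ring n) mvconst S"
    "S \<subseteq> k_subalgebra (mvpoly_ring n) mvconst S"
    unfolding k_subalgebra_def by (auto intro: generate_ring.incl)
  show "a + b \<in> k_subalgebra (mvpoly_ring n) mvconst S"
    if "a \<in> k_subalgebra (mvpoly_ring n) mvconst S" "b \<in> k_subalgebra (mvpoly_ring n) mvconst S"
    using generate_ring.eng_add[OF that[unfolded k_subalgebra_def]] by (simp add: k_subalgebra_def)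
  show "a * b \<in> k_subalgebra (mvpoly_ring n) mvconst S"
    if "a \<in> k_subalgebra (mvpoly_ring n) mvconst S" "b \<in> k_subalgebra (mvpoly_ring n) mvconst S"
    using generate_ring.eng_mult[OF that[unfolded k_subalgebra_def]] by (simp add: k_subalgebra_def)
qed

lemma k_subalgebra_mvpoly_induct [consumes 2, case_names const base add mult]:
  assumes S: "S \<subseteq> carrier (mvpoly_ring n)"
    and a: "a \<in> k_subalgebra (mvpoly_ring n) mvconst S"
    and const: "\<And>c. P (mvconst c)" and base: "\<And>s. s \<in> S \<Longrightarrow> P s"
    and add: "\<And>a b. a \<in> carrier (mvpoly_ring n) \<Longrightarrow> b \<in> carrier (mvpoly_ring n) \<Longrightarrow>
      P a \<Longrightarrow> P b \<Longrightarrow> P (a + b)"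
    and mult: "\<And>a b. a \<in> carrier (mvpoly_ring n) \<Longrightarrow> b \<in> carrier (mvpoly_ring n) \<Longrightarrow>
      P a \<Longrightarrow> P b \<Longrightarrow> P (a * b)"
  shows "P a"
proof -
  interpret R: cring "mvpoly_ring n" by (rule cring_mvpoly_ring)
  have sub: "range mvconst \<union> S \<subseteq> carrier (mvpoly_ring n)" using S by auto
  from a show ?thesis unfolding k_subalgebra_def
  proof (induction rule: generate_ring.induct)
    case one
    then show ?case using const[of 1] by simp
  next
    case (a_inv h)
    have h: "h \<in> carrier (mvpoly_ring n)" using R.generate_ring_in_carrier[OF sub a_inv.hyps] .
    \<comment> \<open>Negation is multiplication by the constant -1, so the induction rule has no
      case for it.\<close>
    have "mvconst (- 1) * h = \<ominus>\<^bsub>mvpoly_ring n\<^esub> h"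
      unfolding a_inv_mvpoly[OF h] by (simp add: mvconst_uminus)
    moreover have "P (mvconst (- 1) * h)" using h a_inv.IH by (intro mult const) auto
    ultimately show ?case by simp
  next
    case (eng_add a b)
    then show ?case using add[of a b] R.generate_ring_in_carrier[OF sub] by simp
  next
    case (eng_mult a b)
    then show ?case using mult[of a b] R.generate_ring_in_carrier[OF sub] by simp
  qed (use const base in auto)
qed

text \<open>
  Some partial derivative lowers the degree of a nonconstant \<open>c\<close>, and \<open>p\<^sup>N\<^sup>+\<^sup>1 | c\<close> implies
  \<open>p\<^sup>N | \<partial>c\<close>; a nonzero constant is not divisible by the nonunit \<open>p\<close>.
\<close>

lemma finite_divisibility:
  fixes p :: "'k::field_char_0 mvpoly"
  assumes p: "p \<in> carrier (mvpoly_ring n)"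
    and nonunit: "\<And>q. q \<in> carrier (mvpoly_ring n) \<Longrightarrow> q * p \<noteq> 1"
    and c: "c \<in> carrier (mvpoly_ring n)" "c \<noteq> 0"
  shows "\<exists>N. \<forall>q\<in>carrier (mvpoly_ring n). c \<noteq> q * p ^ N"
proof -
  interpret subdomain "carrier (mvpoly_ring n) :: 'k mvpoly set" by (rule subdomain_mvpoly)
  \<comment> \<open>The total degree. The induction runs over an upper bound \<open>d\<close> for
    it, so that \<open>d - 1\<close> can be handed to the derivative.\<close>
  define wt where "wt = (\<lambda>t. \<Sum>i<n. Poly_Mapping.lookup (t::nat \<Rightarrow>\<^sub>0 nat) i)"
  have "\<exists>N. \<forall>q\<in>carrier (mvpoly_ring n). c \<noteq> q * p ^ N"
    if "c \<in> carrier (mvpoly_ring n)" "c \<noteq> 0" "\<And>t. t \<in> Poly_Mapping.keys c \<Longrightarrow> wt t \<le> d" for c d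
    using that
  proof (induction d arbitrary: c rule: less_induct)
    case (less d)
    show ?case
    proof (cases "\<forall>l<n. mvpartial l c = 0")
      case True
      then obtain k where k: "c = mvconst k" using mvconst_if_mvpartial_0[of c n] less.prems(1) by auto
      have "c \<noteq> q * p ^ 1" if q: "q \<in> carrier (mvpoly_ring n)" for q
      proof
        assume "c = q * p ^ 1"
        then have "mvconst (inverse k) * q * p = mvconst (inverse k) * mvconst k"
          using k by (simp add: mult.assoc)
        also have "\<dots> = 1" using less.prems(2) k by (simp add: mvconst_mult[symmetric])
        finally show False using nonunit[OF mult_mem[of "mvconst (inverse k)" q]] q by simp
      qed
      then show ?thesis by blast
    next
      case False
      then obtain l where l: "l < n" "mvpartial l c \<noteq> 0" by auto
      note dl = derivation_on_mvpartial[of n l]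
      have wt: "wt (t + Poly_Mapping.single l 1) = Suc (wt t)" for t
        using l(1) by (simp add: wt_def lookup_add sum.distrib lookup_single when_def)
      have key: "t + Poly_Mapping.single l 1 \<in> Poly_Mapping.keys c"
        if "t \<in> Poly_Mapping.keys (mvpartial l c)" for t
        using that by (auto simp: in_keys_iff lookup_mvpartial simp del: of_nat_Suc)
      have wt': "Suc (wt t) \<le> d" if "t \<in> Poly_Mapping.keys (mvpartial l c)" for t
        using less.prems(3)[OF key[OF that]] wt by simp
      obtain t where "t \<in> Poly_Mapping.keys (mvpartial l c)" using l(2)
        by (metis all_not_in_conv keys_eq_empty)
      then have "d > 0" using wt' by fastforce
      then obtain N where N: "\<forall>q\<in>carrier (mvpoly_ring n). mvpartial l c \<noteq> q * p ^ N"
        using less.IH[of "d - 1" "mvpartial l c"] l(2) wt' derivation_mem[OF dl less.prems(1)]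
        by fastforce
      have "c \<noteq> q * p ^ Suc N" if q: "q \<in> carrier (mvpoly_ring n)" for q
      proof
        assume "c = q * p ^ Suc N"
        then have "mvpartial l c =
            (q * of_nat (Suc N) * mvpartial l p + mvpartial l q * p) * p ^ N"
          using derivation_power[OF dl p, of N]
          by (simp add: mvpartial_mult algebra_simps)
        moreover have "q * of_nat (Suc N) * mvpartial l p + mvpartial l q * p \<in> carrier (mvpoly_ring n)"
          using q p derivation_mem[OF dl] by (intro add_mem mult_mem of_nat_mem) auto
        ultimately show False using N by blast
      qed
      then show ?thesis by blast
    qed
  qed
  moreover have "wt t \<le> Max (wt ` Poly_Mapping.keys c)" if "t \<in> Poly_Mapping.keys c" for t
    using that by (intro Max_ge) auto
  ultimately show ?thesis using c by blast
qed

section \<open>Fibres\<close>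

lemma finsum_mvpoly:
  "(\<And>i. i \<in> J \<Longrightarrow> u i \<in> carrier (mvpoly_ring n)) \<Longrightarrow> finsum (mvpoly_ring n) u J = sum u J"
proof -
  interpret R: cring "mvpoly_ring n" by (rule cring_mvpoly_ring)
  show "(\<And>i. i \<in> J \<Longrightarrow> u i \<in> carrier (mvpoly_ring n)) \<Longrightarrow> finsum (mvpoly_ring n) u J = sum u J"
    by (induction J rule: infinite_finite_induct) (simp_all add: R.finsum_insert Pi_def)
qed

lemma fibre_gen_mem:
  fixes f :: "'k::field_char_0 mvpoly"
  assumes "f \<in> carrier (mvpoly_ring n)" shows "f - mvconst \<alpha> \<in> carrier (mvpoly_ring n)"
  using assms by (intro subdomain.minus_mem[OF subdomain_mvpoly]) auto

lemma fibre_ideal_iff: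
  "a \<in> fibre_ideal n f \<alpha> \<longleftrightarrow> (\<exists>q\<in>carrier (mvpoly_ring n). a = q * (f - mvconst \<alpha>))"
  by (auto simp: cgenideal_def)

lemma ideal_fibre:
  fixes f :: "'k::field_char_0 mvpoly"
  assumes "f \<in> carrier (mvpoly_ring n)" shows "ideal (fibre_ideal n f \<alpha>) (mvpoly_ring n)"
  using cring.cgenideal_ideal[OF cring_mvpoly_ring fibre_gen_mem[OF assms]] .

lemma carrier_fibre:
  "carrier (fibre_ring n f \<alpha>) =
    (\<lambda>a. fibre_ideal n f \<alpha> +>\<^bsub>mvpoly_ring n\<^esub> a) ` carrier (mvpoly_ring n)"
  by (auto simp: FactRing_def A_RCOSETS_defs a_r_coset_def simp del: mvpoly_ring_simps)

lemma ring_hom_cring_fibre: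
  fixes f :: "'k::field_char_0 mvpoly"
  assumes "f \<in> carrier (mvpoly_ring n)"
  shows "ring_hom_cring (mvpoly_ring n) (fibre_ring n f \<alpha>)
    (\<lambda>a. fibre_ideal n f \<alpha> +>\<^bsub>mvpoly_ring n\<^esub> a)"
proof -
  interpret I: ideal "fibre_ideal n f \<alpha>" "mvpoly_ring n" by (rule ideal_fibre[OF assms])
  show ?thesis by (rule I.rcos_ring_hom_cring[OF cring_mvpoly_ring])
qed

lemma fibre_coset_eq_zero_iff:
  fixes f :: "'k::field_char_0 mvpoly"
  assumes "f \<in> carrier (mvpoly_ring n)" "a \<in> carrier (mvpoly_ring n)"
  shows "fibre_ideal n f \<alpha> +>\<^bsub>mvpoly_ring n\<^esub> a = \<zero>\<^bsub>fibre_ring n f \<alpha>\<^esub> \<longleftrightarrow> a \<in> fibre_ideal n f \<alpha>"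
proof -
  interpret I: ideal "fibre_ideal n f \<alpha>" "mvpoly_ring n" by (rule ideal_fibre[OF assms(1)])
  show ?thesis
    using I.rcos_const_imp_mem[OF assms(2)] I.a_rcos_const by (auto simp: FactRing_def)
qed

text \<open>\<open>D\<close> is linear over multiples of its constant f - \<alpha>; this is what
  makes the induced map on the fibre well defined.\<close>

lemma derivation_fibre_ideal:
  fixes f :: "'k::field_char_0 mvpoly"
  assumes f: "f \<in> carrier (mvpoly_ring n)" and D: "derivation_on (carrier (mvpoly_ring n)) D"
    and Df: "D (f - mvconst \<alpha>) = 0" and a: "a \<in> fibre_ideal n f \<alpha>"
  shows "D a \<in> fibre_ideal n f \<alpha>"
proof -
  interpret subdomain "carrier (mvpoly_ring n) :: 'k mvpoly set" by (rule subdomain_mvpoly)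
  obtain q where q: "q \<in> carrier (mvpoly_ring n)" "a = q * (f - mvconst \<alpha>)"
    using a by (auto simp: fibre_ideal_iff)
  then have "D a = D q * (f - mvconst \<alpha>)"
    using Df derivation_mult[OF D q(1) fibre_gen_mem[OF f, of \<alpha>]] by simp
  then show ?thesis using derivation_mem[OF D q(1)] by (auto simp: fibre_ideal_iff)
qed

text \<open>Replaces cosets by representatives and membership in the ideal, the form in which both
  directions of the theorem treat independence. The quotient map commutes with the finite sums, and
  the derivations descend because they kill f - \<alpha>.\<close>

lemma lin_indep_fibre_iff:
  fixes f :: "'k::field_char_0 mvpoly"
  assumes f: "f \<in> carrier (mvpoly_ring n)"
    and D: "\<And>i. i < m \<Longrightarrow> derivation_on (carrier (mvpoly_ring n)) (D i)"
    and Df: "\<And>i. i < m \<Longrightarrow> D i (f - mvconst \<alpha>) = 0"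
  shows "lin_indep_maps (fibre_ring n f \<alpha>) m
      (\<lambda>i. induced_map (mvpoly_ring n) (fibre_ideal n f \<alpha>) (D i)) \<longleftrightarrow>
    (\<forall>c. (\<forall>i<m. c i \<in> carrier (mvpoly_ring n)) \<longrightarrow>
      (\<forall>x\<in>carrier (mvpoly_ring n). (\<Sum>i<m. c i * D i x) \<in> fibre_ideal n f \<alpha>) \<longrightarrow>
      (\<forall>i<m. c i \<in> fibre_ideal n f \<alpha>))"
proof -
  let ?A = "carrier (mvpoly_ring n) :: 'k mvpoly set" and ?I = "fibre_ideal n f \<alpha>"
  let ?F = "fibre_ring n f \<alpha>"
  define \<pi> where "\<pi> = (\<lambda>a. ?I +>\<^bsub>mvpoly_ring n\<^esub> a)"
  interpret A: subdomain ?A by (rule subdomain_mvpoly)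
  interpret h: ring_hom_cring "mvpoly_ring n" ?F \<pi>
    unfolding \<pi>_def by (rule ring_hom_cring_fibre[OF f])
  have zero: "\<pi> a = \<zero>\<^bsub>?F\<^esub> \<longleftrightarrow> a \<in> ?I" if "a \<in> ?A" for a
    unfolding \<pi>_def by (rule fibre_coset_eq_zero_iff[OF f that])
  have F: "carrier ?F = \<pi> ` ?A" unfolding \<pi>_def by (rule carrier_fibre)
  have ind: "induced_map (mvpoly_ring n) ?I (D i) (\<pi> x) = \<pi> (D i x)" if i: "i < m" and x: "x \<in> ?A" for i x
    unfolding \<pi>_def
  proof (rule h.R.induced_map_coset[OF ideal_fibre[OF f] _ _ _ x])
    show "D i \<in> ?A \<rightarrow> ?A" using D[OF i] unfolding derivation_on_def by blast
    show "D i (a \<oplus>\<^bsub>mvpoly_ring n\<^esub> b) = D i a \<oplus>\<^bsub>mvpoly_ring n\<^esub> D i b" if "a \<in> ?A" "b \<in> ?A" for a b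
      using A.derivation_add[OF D[OF i] that] by simp
    show "D i a \<in> ?I" if "a \<in> ?I" for a
      using derivation_fibre_ideal[OF f D[OF i] Df[OF i] that] .
  qed
  \<comment> \<open>The cosets \<open>C\<close> are kept apart from their representatives
    \<open>c\<close>: one direction starts from \<open>c\<close>, the other chooses \<open>c\<close>
    for a given \<open>C\<close>.\<close>
  have lin: "(\<Oplus>\<^bsub>?F\<^esub>i\<in>{..<m}. C i \<otimes>\<^bsub>?F\<^esub> induced_map (mvpoly_ring n) ?I (D i) (\<pi> x)) =
      \<pi> (\<Sum>i<m. c i * D i x)"
    if c: "\<And>i. i < m \<Longrightarrow> c i \<in> ?A" "\<And>i. i < m \<Longrightarrow> C i = \<pi> (c i)" and x: "x \<in> ?A" for C c x
  proof -
    have mem: "c i * D i x \<in> ?A" if "i < m" for i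
      using A.mult_mem[OF c(1)[OF that] A.derivation_mem[OF D[OF that] x]] .
    have "\<pi> (\<Sum>i<m. c i * D i x) = \<pi> (finsum (mvpoly_ring n) (\<lambda>i. c i * D i x) {..<m})"
      using mem by (subst finsum_mvpoly) auto
    also have "\<dots> = finsum ?F (\<pi> \<circ> (\<lambda>i. c i * D i x)) {..<m}"
      using mem by (intro h.hom_finsum) auto
    also have "\<dots> = (\<Oplus>\<^bsub>?F\<^esub>i\<in>{..<m}. C i \<otimes>\<^bsub>?F\<^esub> induced_map (mvpoly_ring n) ?I (D i) (\<pi> x))"
    proof (rule h.S.finsum_cong')
      fix i assume "i \<in> {..<m}"
      then have i: "i < m" by simp
      have "\<pi> (c i * D i x) = \<pi> (c i) \<otimes>\<^bsub>?F\<^esub> \<pi> (D i x)"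
        using h.hom_mult[OF c(1)[OF i] A.derivation_mem[OF D[OF i] x]] by simp
      then show "(\<pi> \<circ> (\<lambda>i. c i * D i x)) i = C i \<otimes>\<^bsub>?F\<^esub> induced_map (mvpoly_ring n) ?I (D i) (\<pi> x)"
        using c(2)[OF i] ind[OF i x] by simp
    next
      show "(\<lambda>i. C i \<otimes>\<^bsub>?F\<^esub> induced_map (mvpoly_ring n) ?I (D i) (\<pi> x)) \<in> {..<m} \<rightarrow> carrier ?F"
      proof
        fix i assume "i \<in> {..<m}"
        then have i: "i < m" by simp
        have "\<pi> (c i) \<otimes>\<^bsub>?F\<^esub> \<pi> (D i x) \<in> carrier ?F"
          by (intro h.S.m_closed h.hom_closed c(1) i A.derivation_mem[OF D] x)
        then show "C i \<otimes>\<^bsub>?F\<^esub> induced_map (mvpoly_ring n) ?I (D i) (\<pi> x) \<in> carrier ?F"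
          using c(2)[OF i] ind[OF i x] by simp
      qed
    qed simp
    finally show ?thesis by simp
  qed
  have sum_mem: "(\<Sum>i<m. c i * D i x) \<in> ?A"
    if "\<And>i. i < m \<Longrightarrow> c i \<in> ?A" and "x \<in> ?A" for c x
    by (intro A.sum_mem A.mult_mem A.derivation_mem[OF D] that) simp_all
  show ?thesis
  proof (intro iffI allI impI)
    fix c i
    assume L: "lin_indep_maps ?F m (\<lambda>i. induced_map (mvpoly_ring n) ?I (D i))"
      and c: "\<forall>i<m. c i \<in> ?A" and 0: "\<forall>x\<in>?A. (\<Sum>i<m. c i * D i x) \<in> ?I" and i: "i < m"
    have sum0: "(\<Oplus>\<^bsub>?F\<^esub>i\<in>{..<m}. \<pi> (c i) \<otimes>\<^bsub>?F\<^esub> induced_map (mvpoly_ring n) ?I (D i) y) = \<zero>\<^bsub>?F\<^esub>"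
      if y: "y \<in> carrier ?F" for y
    proof -
      obtain x where x: "x \<in> ?A" "y = \<pi> x" by (rule imageE[OF y[unfolded F]])
      have c': "\<And>i. i < m \<Longrightarrow> c i \<in> ?A" using c by blast
      have "\<pi> (\<Sum>i<m. c i * D i x) = \<zero>\<^bsub>?F\<^esub>"
        by (rule iffD2[OF zero[OF sum_mem[OF c' x(1)]] bspec[OF 0 x(1)]])
      with lin[OF c' refl x(1)] show ?thesis unfolding x(2) by (rule trans)
    qed
    have "(\<lambda>i. \<pi> (c i)) \<in> {..<m} \<rightarrow> carrier ?F"
      using c by (intro funcsetI h.hom_closed) simp
    from bspec[OF L[unfolded lin_indep_maps_def] this] sum0 i have "\<pi> (c i) = \<zero>\<^bsub>?F\<^esub>" by simp
    then show "c i \<in> ?I" using zero[of "c i"] c i by simp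
  next
    assume R: "\<forall>c. (\<forall>i<m. c i \<in> ?A) \<longrightarrow> (\<forall>x\<in>?A. (\<Sum>i<m. c i * D i x) \<in> ?I) \<longrightarrow> (\<forall>i<m. c i \<in> ?I)"
    show "lin_indep_maps ?F m (\<lambda>i. induced_map (mvpoly_ring n) ?I (D i))"
      unfolding lin_indep_maps_def
    proof (intro ballI impI allI)
      fix C i
      assume C: "C \<in> {..<m} \<rightarrow> carrier ?F" and i: "i < m"
        and 0: "\<forall>y\<in>carrier ?F.
          (\<Oplus>\<^bsub>?F\<^esub>i\<in>{..<m}. C i \<otimes>\<^bsub>?F\<^esub> induced_map (mvpoly_ring n) ?I (D i) y) = \<zero>\<^bsub>?F\<^esub>"
      have "\<exists>a. a \<in> ?A \<and> C i = \<pi> a" if "i < m" for i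
        using C that unfolding F by (simp add: Pi_iff image_iff Bex_def)
      then obtain c where c: "\<And>i. i < m \<Longrightarrow> c i \<in> ?A" "\<And>i. i < m \<Longrightarrow> C i = \<pi> (c i)" by metis
      have "(\<Sum>i<m. c i * D i x) \<in> ?I" if x: "x \<in> ?A" for x
      proof -
        have "\<pi> (\<Sum>i<m. c i * D i x) = \<zero>\<^bsub>?F\<^esub>"
          using trans[OF lin[OF c x, symmetric] bspec[OF 0 h.hom_closed[OF x]]] .
        moreover have "(\<Sum>i<m. c i * D i x) \<in> ?A" by (rule sum_mem[OF c(1) x])
        ultimately show ?thesis using zero by blast
      qed
      then have "c i \<in> ?I" using R[rule_format, of c i] c(1) i by simp
      then show "C i = \<zero>\<^bsub>?F\<^esub>" using c i zero[of "c i"] by simp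
    qed
  qed
qed

text \<open>\<open>\<phi>\<close> is the quotient map followed by the isomorphism. The affine fibres
  are used below only through this map on \<open>A\<close> and its kernel.\<close>

lemma fibre_iso_mvpoly:
  fixes f :: "'k::field_char_0 mvpoly"
  assumes f: "f \<in> carrier (mvpoly_ring n)"
    and iso: "k_alg_iso (fibre_ring n f \<alpha>) (\<lambda>c. fibre_ideal n f \<alpha> +>\<^bsub>mvpoly_ring n\<^esub> mvconst c)
                    (mvpoly_ring m) mvconst"
  obtains \<phi> where "\<phi> ` carrier (mvpoly_ring n) = carrier (mvpoly_ring m)"
    "\<forall>a\<in>carrier (mvpoly_ring n). \<forall>b\<in>carrier (mvpoly_ring n). \<phi> (a + b) = \<phi> a + \<phi> b"
    "\<forall>a\<in>carrier (mvpoly_ring n). \<forall>b\<in>carrier (mvpoly_ring n). \<phi> (a * b) = \<phi> a * \<phi> b"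
    "\<forall>c. \<phi> (mvconst c) = mvconst c"
    "\<forall>a\<in>carrier (mvpoly_ring n). \<phi> a = 0 \<longleftrightarrow> a \<in> fibre_ideal n f \<alpha>"
proof -
  let ?A = "carrier (mvpoly_ring n) :: 'k mvpoly set" and ?I = "fibre_ideal n f \<alpha>"
  let ?F = "fibre_ring n f \<alpha>"
  define \<pi> where "\<pi> = (\<lambda>a. ?I +>\<^bsub>mvpoly_ring n\<^esub> a)"
  interpret h: ring_hom_cring "mvpoly_ring n" ?F \<pi>
    unfolding \<pi>_def by (rule ring_hom_cring_fibre[OF f])
  have F: "carrier ?F = \<pi> ` ?A" unfolding \<pi>_def by (rule carrier_fibre)
  obtain g where g: "g \<in> ring_iso ?F (mvpoly_ring m)" "\<And>c. g (\<pi> (mvconst c)) = mvconst c"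
    using iso unfolding k_alg_iso_def \<pi>_def by blast
  have hom: "g \<in> ring_hom ?F (mvpoly_ring m)" and bij: "bij_betw g (carrier ?F) (carrier (mvpoly_ring m))"
    using g(1) by (auto simp: ring_iso_def)
  have g0: "g \<zero>\<^bsub>?F\<^esub> = 0"
    using ring_hom_zero[OF hom h.S.ring_axioms cring.axioms(1)[OF cring_mvpoly_ring]] by simp
  show ?thesis
  proof (rule that[of "g \<circ> \<pi>"]; (intro ballI allI)?)
    show "(g \<circ> \<pi>) ` ?A = carrier (mvpoly_ring m)"
      using bij by (metis F bij_betw_def image_comp)
    show "(g \<circ> \<pi>) (a + b) = (g \<circ> \<pi>) a + (g \<circ> \<pi>) b" if "a \<in> ?A" "b \<in> ?A" for a b
      using h.hom_add[OF that] ring_hom_add[OF hom h.hom_closed[OF that(1)] h.hom_closed[OF that(2)]]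
      by simp
    show "(g \<circ> \<pi>) (a * b) = (g \<circ> \<pi>) a * (g \<circ> \<pi>) b" if "a \<in> ?A" "b \<in> ?A" for a b
      using h.hom_mult[OF that] ring_hom_mult[OF hom h.hom_closed[OF that(1)] h.hom_closed[OF that(2)]]
      by simp
    show "(g \<circ> \<pi>) (mvconst c) = mvconst c" for c using g(2) by simp
    show "(g \<circ> \<pi>) a = 0 \<longleftrightarrow> a \<in> ?I" if a: "a \<in> ?A" for a
    proof -
      have "g (\<pi> a) = 0 \<longleftrightarrow> \<pi> a = \<zero>\<^bsub>?F\<^esub>"
        using bij h.hom_closed[OF a] h.S.zero_closed g0
        by (metis bij_betw_def inj_onD)
      also have "\<dots> \<longleftrightarrow> a \<in> ?I" unfolding \<pi>_def by (rule fibre_coset_eq_zero_iff[OF f a])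
      finally show ?thesis by simp
    qed
  qed
qed

section \<open>Derivations dual to a coordinate system\<close>

lemma (in subdomain) derivation_iterate_add:
  assumes D: "derivation_on A D" and "a \<in> A" "b \<in> A"
  shows "(D ^^ j) (a + b) = (D ^^ j) a + (D ^^ j) b"
  by (induction j)
    (simp_all add: assms derivation_add[OF D] derivation_iterate_mem[OF D])

lemma (in subdomain) derivation_iterate_eq_0_mono:
  assumes D: "derivation_on A D" and "(D ^^ j) a = 0" "j \<le> k"
  shows "(D ^^ k) a = 0"
  using assms(3) by (induction rule: dec_induct) (simp_all add: assms(2) derivation_zero[OF D])

text \<open>Every term of the Leibniz expansion differentiates \<open>a\<close> at least
  \<open>j\<close> times or \<open>b\<close> at least \<open>k\<close> times. Induction on
  \<open>j + k\<close> avoids binomial coefficients: both summands of \<open>D (a * b)\<close> have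
  total order one less.\<close>

lemma (in subdomain) derivation_iterate_mult_eq_0:
  assumes D: "derivation_on A D" and "a \<in> A" "b \<in> A" "(D ^^ j) a = 0" "(D ^^ k) b = 0"
  shows "(D ^^ (j + k)) (a * b) = 0"
  using assms(2-)
proof (induction "j + k" arbitrary: j k a b)
  case 0
  then show ?case by simp
next
  case (Suc r)
  have D0: "(D ^^ i) 0 = 0" for i
    by (rule derivation_iterate_eq_0_mono[OF D, of 0]) simp_all
  consider "j = 0" | "k = 0" | j' k' where "j = Suc j'" "k = Suc k'"
    by (metis not0_implies_Suc)
  then show ?case
  proof cases
    case 3
    have mem: "D a \<in> A" "D b \<in> A" using Suc.prems derivation_mem[OF D] by auto
    have r: "r = j + k'" "r = j' + k" using Suc.hyps(2) 3 by simp_all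
    have "(D ^^ r) (a * D b) = 0" unfolding r(1)
      using Suc.prems mem 3 by (intro Suc.hyps(1) r) (simp_all add: funpow_swap1)
    moreover have "(D ^^ r) (D a * b) = 0" unfolding r(2)
      using Suc.prems mem 3 by (intro Suc.hyps(1) r) (simp_all add: funpow_swap1)
    ultimately have "(D ^^ r) (a * D b + D a * b) = 0"
      using Suc.prems mem by (simp add: derivation_iterate_add[OF D] mult_mem)
    then show ?thesis
      using Suc.prems by (simp add: Suc.hyps(2)[symmetric] funpow_swap1 derivation_mult[OF D])
  qed (use Suc.prems D0 in simp_all)
qed


text \<open>This is the formula \<open>da = \<Sum> u j dg j\<close> for Kaehler differentials. The
  point is the order of the quantifiers: \<open>u\<close> depends on \<open>a\<close> alone and
  serves all derivations \<open>d\<close> at once.\<close>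

lemma differential_in_generators:
  fixes g :: "nat \<Rightarrow> 'k::field_char_0 mvpoly"
  assumes g: "\<And>j. j < r \<Longrightarrow> g j \<in> carrier (mvpoly_ring n)"
    and a: "a \<in> k_subalgebra (mvpoly_ring n) mvconst (g ` {..<r})"
  shows "\<exists>u. (\<forall>j<r. u j \<in> carrier (mvpoly_ring n)) \<and>
    (\<forall>d. derivation_on (carrier (mvpoly_ring n)) d \<longrightarrow> (\<forall>c. d (mvconst c) = 0) \<longrightarrow>
      d a = (\<Sum>j<r. u j * d (g j)))"
proof -
  interpret subdomain "carrier (mvpoly_ring n) :: 'k mvpoly set" by (rule subdomain_mvpoly)
  have "g ` {..<r} \<subseteq> carrier (mvpoly_ring n)" using g by auto
  from this a show ?thesis
  proof (induction rule: k_subalgebra_mvpoly_induct)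
    case (const c)
    show ?case using zero_mem by (intro exI[of _ "\<lambda>_. 0"]) simp
  next
    case (base s)
    then obtain i where i: "i < r" "s = g i" by auto
    have "(\<Sum>j<r. (if j = i then 1 else 0) * d (g j)) = d (g i)" for d :: "'k mvpoly \<Rightarrow> 'k mvpoly"
      using i(1) by (subst sum.remove[of _ i]) auto
    then show ?case using i zero_mem one_mem by (intro exI[of _ "\<lambda>j. if j = i then 1 else 0"]) simp
  next
    case (add a b)
    then obtain u v where
      u: "\<And>j. j < r \<Longrightarrow> u j \<in> carrier (mvpoly_ring n)" "\<And>d. derivation_on (carrier (mvpoly_ring n)) d \<Longrightarrow>
        (\<And>c. d (mvconst c) = 0) \<Longrightarrow> d a = (\<Sum>j<r. u j * d (g j))" and
      v: "\<And>j. j < r \<Longrightarrow> v j \<in> carrier (mvpoly_ring n)" "\<And>d. derivation_on (carrier (mvpoly_ring n)) d \<Longrightarrow>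
        (\<And>c. d (mvconst c) = 0) \<Longrightarrow> d b = (\<Sum>j<r. v j * d (g j))"
      by blast
    have "d (a + b) = (\<Sum>j<r. (u j + v j) * d (g j))"
      if d: "derivation_on (carrier (mvpoly_ring n)) d" "\<And>c. d (mvconst c) = 0" for d
      unfolding derivation_add[OF d(1) add(1,2)] u(2)[OF d] v(2)[OF d]
      by (simp add: distrib_right sum.distrib)
    moreover have "u j + v j \<in> carrier (mvpoly_ring n)" if "j < r" for j
      using u(1) v(1) that by (intro add_mem)
    ultimately show ?case by (intro exI[of _ "\<lambda>j. u j + v j"]) blast
  next
    case (mult a b)
    then obtain u v where
      u: "\<And>j. j < r \<Longrightarrow> u j \<in> carrier (mvpoly_ring n)" "\<And>d. derivation_on (carrier (mvpoly_ring n)) d \<Longrightarrow>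
        (\<And>c. d (mvconst c) = 0) \<Longrightarrow> d a = (\<Sum>j<r. u j * d (g j))" and
      v: "\<And>j. j < r \<Longrightarrow> v j \<in> carrier (mvpoly_ring n)" "\<And>d. derivation_on (carrier (mvpoly_ring n)) d \<Longrightarrow>
        (\<And>c. d (mvconst c) = 0) \<Longrightarrow> d b = (\<Sum>j<r. v j * d (g j))"
      by blast
    have "d (a * b) = (\<Sum>j<r. (a * v j + b * u j) * d (g j))"
      if d: "derivation_on (carrier (mvpoly_ring n)) d" "\<And>c. d (mvconst c) = 0" for d
      unfolding derivation_mult[OF d(1) mult(1,2)] u(2)[OF d] v(2)[OF d]
      by (simp add: sum.distrib sum_distrib_left algebra_simps)
    moreover have "a * v j + b * u j \<in> carrier (mvpoly_ring n)" if "j < r" for j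
      using u(1) v(1) that mult(1,2) by (intro add_mem mult_mem)
    ultimately show ?case by (intro exI[of _ "\<lambda>j. a * v j + b * u j"]) blast
  qed
qed

text \<open>
  The chain rule gives the Jacobian matrix of a generating family a left inverse, hence a two-sided
  inverse \<open>H\<close>; the columns of \<open>H\<close> are the derivations dual to the generators.
\<close>

lemma dual_derivations:
  fixes g :: "nat \<Rightarrow> 'k::field_char_0 mvpoly"
  assumes g: "\<And>j. j < n \<Longrightarrow> g j \<in> carrier (mvpoly_ring n)"
    and gen: "k_subalgebra (mvpoly_ring n) mvconst (g ` {..<n}) = carrier (mvpoly_ring n)"
  obtains E where "commuting_lnds (carrier (mvpoly_ring n)) {..<n} E"
    "\<forall>i c. E i (mvconst c) = 0"
    "\<forall>i<n. \<forall>j<n. E j (g i) = (if i = j then 1 else 0)"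
    "\<forall>a\<in>carrier (mvpoly_ring n). (\<forall>i<n. E i a = 0) \<longrightarrow> (\<exists>c. a = mvconst c)"
proof -
  let ?A = "carrier (mvpoly_ring n) :: 'k mvpoly set"
  interpret subdomain ?A by (rule subdomain_mvpoly)
  have gsub: "g ` {..<n} \<subseteq> ?A" using g by auto
  have partial: "derivation_on ?A (mvpartial l)" "\<And>c. mvpartial l (mvconst c) = 0" for l
    by (simp_all add: derivation_on_mvpartial)
  define P where "P = (\<lambda>a u. (\<forall>j<n. u j \<in> ?A) \<and>
    (\<forall>d. derivation_on ?A d \<longrightarrow> (\<forall>c. d (mvconst c) = 0) \<longrightarrow> d a = (\<Sum>j<n. u j * d (g j))))"
  have P: "u j \<in> ?A" if "P a u" "j < n" for a u j
    using that by (simp add: P_def)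
  have Pd: "d a = (\<Sum>j<n. u j * d (g j))"
    if "P a u" "derivation_on ?A d" "\<And>c. d (mvconst c) = 0" for a u d
    using that by (simp add: P_def)
  have diff: "\<exists>u. P a u" if a: "a \<in> ?A" for a
    unfolding P_def by (rule differential_in_generators[OF g]) (simp_all only: gen a)
  have "\<exists>u. l < n \<longrightarrow> P (mvX l) u" for l
    using diff[of "mvX l"] by auto
  \<comment> \<open>\<open>H l j\<close> plays the role of the derivative of \<open>x_l\<close> with
    respect to \<open>g j\<close>. Evaluating the differential of \<open>x_l\<close> at the i-th
    partial derivative gives \<open>H J = 1\<close>.\<close>
  then obtain H where H: "\<And>l. l < n \<Longrightarrow> P (mvX l) (H l)"
    by metis
  have HJ: "(\<Sum>j<n. H l j * mvpartial i (g j)) = (if l = i then 1 else 0)" if "l < n" "i < n" for l i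
    using Pd[OF H[OF that(1)] partial(1)] by (simp add: mvpartial_mvX)
  have JH: "(\<Sum>l<n. mvpartial l (g i) * H l j) = (if i = j then 1 else 0)" if "i < n" "j < n" for i j
    by (rule right_inverse_from_left_inverse)
      (use that HJ derivation_mem[OF partial(1) g] in \<open>simp_all del: mvpoly_ring_simps\<close>)
  define E where "E = (\<lambda>j a. \<Sum>l<n. H l j * mvpartial l a)"
  have Eg: "E j (g i) = (if i = j then 1 else 0)" if "i < n" "j < n" for i j
    using JH[OF that] by (simp add: E_def mult.commute)
  have Ec: "E j (mvconst c) = 0" for j c by (simp add: E_def)
  have Ed: "derivation_on ?A (E j)" if j: "j < n" for j
    unfolding derivation_on_def
  proof (intro conjI ballI funcsetI)
    show "E j a \<in> ?A" if "a \<in> ?A" for a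
      unfolding E_def by (intro sum_mem mult_mem P[OF H] j derivation_mem[OF partial(1)] that) simp_all
    show "E j (a + b) = E j a + E j b" for a b
      by (simp add: E_def mvpartial_add distrib_left sum.distrib)
    show "E j (a * b) = a * E j b + E j a * b" for a b
      by (simp add: E_def mvpartial_mult algebra_simps sum.distrib sum_distrib_left sum_distrib_right)
  qed
  \<comment> \<open>The commutator of \<open>E i\<close> and \<open>E j\<close> acts as a derivation
    and vanishes on the generators, whose images are the constants 0 and 1.\<close>
  have comm: "E i (E j a) = E j (E i a)" if ij: "i < n" "j < n" and "a \<in> ?A" for i j a
  proof -
    note di = Ed[OF ij(1)] and dj = Ed[OF ij(2)]
    note m = derivation_mem[OF di] derivation_mem[OF dj]
    have a: "a \<in> k_subalgebra (mvpoly_ring n) mvconst (g ` {..<n})" using that(3) by (simp only: gen)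
    from gsub a show ?thesis
    proof (induction rule: k_subalgebra_mvpoly_induct)
      case (const c)
      then show ?case by (simp add: Ec derivation_zero[OF di] derivation_zero[OF dj])
    next
      case (base s)
      then obtain k where "k < n" "s = g k" by auto
      then show ?case
        using ij by (simp add: Eg derivation_zero[OF di] derivation_zero[OF dj] derivation_one[OF di] derivation_one[OF dj])
    next
      case (add a b)
      then show ?case by (simp add: derivation_add[OF di] derivation_add[OF dj] m del: mvpoly_ring_simps)
    next
      case (mult a b)
      then show ?case
        by (simp add: derivation_mult[OF di] derivation_mult[OF dj] derivation_add[OF di] derivation_add[OF dj]
            m mult_mem algebra_simps del: mvpoly_ring_simps)
    qed
  qed
  \<comment> \<open>Two applications of \<open>E j\<close> kill each generator, and nilpotency at an
    element passes to sums and products.\<close>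
  have nil: "nilpotent_on ?A (E j)" if j: "j < n" for j
    unfolding nilpotent_on_def
  proof
    fix a assume "a \<in> ?A"
    then have a: "a \<in> k_subalgebra (mvpoly_ring n) mvconst (g ` {..<n})" by (simp only: gen)
    note d = Ed[OF j]
    from gsub a show "\<exists>k. (E j ^^ k) a = 0"
    proof (induction rule: k_subalgebra_mvpoly_induct)
      case (const c)
      show ?case by (rule exI[of _ 1]) (simp add: Ec)
    next
      case (base s)
      then obtain k where "k < n" "s = g k" by auto
      then have "(E j ^^ 2) s = 0"
        using j by (simp add: Eg numeral_2_eq_2 derivation_zero[OF d] derivation_one[OF d])
      then show ?case by blast
    next
      case (add a b)
      then obtain k l where "(E j ^^ k) a = 0" "(E j ^^ l) b = 0" by blast
      then have "(E j ^^ max k l) (a + b) = 0"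
        using derivation_iterate_eq_0_mono[OF d, of k a "max k l"]
          derivation_iterate_eq_0_mono[OF d, of l b "max k l"] derivation_iterate_add[OF d add(1,2)] by simp
      then show ?case by blast
    next
      case (mult a b)
      then show ?case using derivation_iterate_mult_eq_0[OF d mult(1,2)] by blast
    qed
  qed
  \<comment> \<open>Evaluating the differential of \<open>a\<close> at \<open>E i\<close> isolates
    \<open>u i\<close>. If all \<open>E i a\<close> vanish then so does \<open>u\<close>, and with
    it every partial derivative of \<open>a\<close>.\<close>
  have ker: "\<exists>c. a = mvconst c" if a: "a \<in> ?A" and 0: "\<forall>i<n. E i a = 0" for a
  proof -
    obtain u where "P a u" using diff[OF a] ..
    note u = Pd[OF this]
    have "u i = 0" if i: "i < n" for i
    proof -
      have "E i a = (\<Sum>j<n. u j * (if j = i then 1 else 0))"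
        unfolding u[OF Ed[OF i] Ec] by (intro sum.cong refl) (simp add: Eg i)
      also have "\<dots> = u i" using i by (subst sum.remove[of _ i]) auto
      finally show ?thesis using 0 i by simp
    qed
    then have "mvpartial l a = 0" for l using u[OF partial] by simp
    then show ?thesis using a by (intro mvconst_if_mvpartial_0) auto
  qed
  show ?thesis
  proof (rule that)
    show "commuting_lnds ?A {..<n} E"
      by unfold_locales (use Ed nil comm in \<open>simp_all del: mvpoly_ring_simps\<close>)
  qed (use Ec Eg ker in blast)+
qed

text \<open>Factorials are invertible constants in characteristic zero. This discharges the
  cancellation hypotheses of \<open>slice_induction\<close> and
  \<open>slices_generate\<close>.\<close>

lemma k_subalgebra_fact_cancel:
  fixes a :: "'k::field_char_0 mvpoly"
  assumes "S \<subseteq> carrier (mvpoly_ring n)" and "fact j * a \<in> k_subalgebra (mvpoly_ring n) mvconst S"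
  shows "a \<in> k_subalgebra (mvpoly_ring n) mvconst S"
proof -
  have "mvconst (fact j) = (fact j :: 'k mvpoly)" by (metis mvconst_of_nat of_nat_fact)
  then have "mvconst (inverse (fact j)) * (fact j * a) = a"
    using mvconst_inverse_mult[of "fact j" a] by simp
  then show ?thesis
    using k_subalgebra_mvpoly(5)[OF assms(1) k_subalgebra_mvpoly(2)[OF assms(1)] assms(2)] by metis
qed

text \<open>\<open>f\<close> is itself a slice of \<open>E 0\<close> on the joint kernel of the
  other \<open>E i\<close>, and the elements of that kernel which \<open>E 0\<close> also kills are
  constants. Slice induction then identifies the joint kernel with k[f].\<close>

lemma coordinate_imp_commuting_derivations:
  fixes f :: "'k::field_char_0 mvpoly"
  assumes n: "n \<ge> 1" and "coordinate n f"
  shows "\<exists>D :: nat \<Rightarrow> 'k mvpoly \<Rightarrow> 'k mvpoly.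
           (\<forall>i<n-1. k_derivation (mvpoly_ring n) mvconst (D i) \<and>
                     locally_nilpotent (mvpoly_ring n) (D i)) \<and>
           (\<forall>i<n-1. \<forall>j<n-1. \<forall>a\<in>carrier (mvpoly_ring n). D i (D j a) = D j (D i a)) \<and>
           common_kernel (mvpoly_ring n) (n - 1) D = k_subalgebra (mvpoly_ring n) mvconst {f} \<and>
           (\<forall>\<alpha>. lin_indep_maps (fibre_ring n f \<alpha>) (n - 1)
                  (\<lambda>i. induced_map (mvpoly_ring n) (fibre_ideal n f \<alpha>) (D i)))"
proof -
  let ?A = "carrier (mvpoly_ring n) :: 'k mvpoly set"
  obtain g where g0: "g 0 = f" and g: "\<And>i. i < n \<Longrightarrow> g i \<in> ?A"
    and gen: "k_subalgebra (mvpoly_ring n) mvconst (g ` {..<n}) = ?A"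
    using assms(2) unfolding coordinate_def by blast
  obtain E where E: "commuting_lnds ?A {..<n} E"
    and Ec: "\<forall>i c. E i (mvconst c) = 0"
    and Eg: "\<forall>i<n. \<forall>j<n. E j (g i) = (if i = j then 1 else 0)"
    and Eker: "\<forall>a\<in>?A. (\<forall>i<n. E i a = 0) \<longrightarrow> (\<exists>c. a = mvconst c)"
    by (rule dual_derivations[OF g gen])
  interpret E: commuting_lnds ?A "{..<n}" E by (rule E)
  have f: "f \<in> ?A" "{f} \<subseteq> ?A" using g[of 0] n g0 by auto
  \<comment> \<open>The shift leaves out \<open>E 0\<close>, the derivation dual to
    \<open>g 0 = f\<close>.\<close>
  define D where "D = (\<lambda>i. E (Suc i))"
  have lt: "Suc i < n" if "i < n - 1" for i using that by simp
  have Dd: "derivation_on ?A (D i)" if "i < n - 1" for i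
    unfolding D_def using lt[OF that] by (intro E.der) simp
  have Ef: "E i f = 0" if "0 < i" "i < n" for i
    using Eg[rule_format, of 0 i] that n g0 by simp
  let ?T = "k_subalgebra (mvpoly_ring n) mvconst {f}"
  note T = k_subalgebra_mvpoly[OF f(2)]
  have "E.joint_ker {1..<n} \<subseteq> ?T"
  proof (rule E.slice_induction[of _ 0 f])
    show "f \<in> E.joint_ker {1..<n}" using f(1) Ef by (auto simp: E.joint_ker_def)
    show "E 0 f = 1" using Eg[rule_format, of 0 0] n g0 by simp
    have "insert 0 {1..<n} = {..<n}" using n by auto
    then show "E.joint_ker (insert 0 {1..<n}) \<subseteq> ?T"
      using Eker T(2) by (fastforce simp: E.joint_ker_def simp del: mvpoly_ring_simps)
    show "a \<in> ?T" if "fact j * a \<in> ?T" for j a using k_subalgebra_fact_cancel[OF f(2) that] .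
  qed (use n T in auto)
  moreover have "?T \<subseteq> E.joint_ker {1..<n}"
  proof
    fix a assume "a \<in> ?T"
    with f(2) have "a \<in> ?A \<and> (\<forall>i\<in>{1..<n}. E i a = 0)"
    proof (induction rule: k_subalgebra_mvpoly_induct)
      case (const c)
      then show ?case by (simp add: Ec)
    next
      case (base s)
      then show ?case using f Ef by auto
    next
      case (add a b)
      then show ?case using E.der by (auto simp: E.derivation_add intro: E.add_mem simp del: mvpoly_ring_simps)
    next
      case (mult a b)
      then show ?case using E.der by (auto simp: E.derivation_mult intro: E.mult_mem simp del: mvpoly_ring_simps)
    qed
    then show "a \<in> E.joint_ker {1..<n}" by (simp add: E.joint_ker_def)
  qed
  ultimately have "?T = E.joint_ker {1..<n}" by blast
  also have "\<dots> = common_kernel (mvpoly_ring n) (n - 1) D"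
  proof -
    have "(\<forall>i<n - 1. E (Suc i) a = 0) \<longleftrightarrow> (\<forall>i\<in>{1..<n}. E i a = 0)" for a
    proof (intro iffI ballI allI impI)
      fix i assume "\<forall>i<n - 1. E (Suc i) a = 0" "i \<in> {1..<n}"
      then show "E i a = 0" by (cases i) auto
    qed auto
    then show ?thesis by (simp add: common_kernel_def E.joint_ker_def D_def)
  qed
  finally have ker: "common_kernel (mvpoly_ring n) (n - 1) D = ?T" by simp
  have indep: "lin_indep_maps (fibre_ring n f \<alpha>) (n - 1)
      (\<lambda>i. induced_map (mvpoly_ring n) (fibre_ideal n f \<alpha>) (D i))" for \<alpha>
  proof (subst lin_indep_fibre_iff[OF f(1) Dd])
    show "D i (f - mvconst \<alpha>) = 0" if i: "i < n - 1" for i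
    proof -
      have "D i (f - mvconst \<alpha>) = D i f - D i (mvconst \<alpha>)"
        by (rule E.derivation_minus[OF Dd[OF i] f(1)]) simp
      then show ?thesis using lt[OF i] Ef[of "Suc i"] Ec by (simp add: D_def)
    qed
    show "\<forall>c. (\<forall>i<n - 1. c i \<in> ?A) \<longrightarrow>
        (\<forall>x\<in>?A. (\<Sum>i<n - 1. c i * D i x) \<in> fibre_ideal n f \<alpha>) \<longrightarrow>
        (\<forall>i<n - 1. c i \<in> fibre_ideal n f \<alpha>)"
    proof (intro allI impI)
      fix c j
      assume c: "\<forall>x\<in>?A. (\<Sum>i<n - 1. c i * D i x) \<in> fibre_ideal n f \<alpha>" and j: "j < n - 1"
      \<comment> \<open>Evaluating the relation at the generator dual to \<open>D j\<close> leaves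
        \<open>c j\<close> alone.\<close>
      have "(\<Sum>i<n - 1. c i * D i (g (Suc j))) = (\<Sum>i<n - 1. c i * (if i = j then 1 else 0))"
        using lt j by (intro sum.cong refl) (simp add: D_def Eg)
      also have "\<dots> = c j" using j by (subst sum.remove[of _ j]) auto
      finally show "c j \<in> fibre_ideal n f \<alpha>" using bspec[OF c g[OF lt[OF j]]] by simp
    qed
  qed
  show ?thesis
  proof (intro exI[of _ D] conjI allI impI ballI)
    fix i assume i: "i < n - 1"
    show "k_derivation (mvpoly_ring n) mvconst (D i)"
      using Dd[OF i] Ec by (simp add: k_derivation_mvpoly_iff D_def del: mvpoly_ring_simps)
    show "locally_nilpotent (mvpoly_ring n) (D i)"
      using E.nil lt[OF i] by (simp add: locally_nilpotent_mvpoly_iff D_def)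
    show "D i (D j a) = D j (D i a)" if "j < n - 1" "a \<in> ?A" for j a
      unfolding D_def using lt[OF i] lt[OF that(1)] that(2) by (intro E.comm) simp_all
  qed (use ker indep in simp_all)
qed

section \<open>Coordinates from commuting derivations\<close>

text \<open>
  Writing the induced derivations of \<open>k\<^sup>[\<^sup>m\<^sup>]\<close> as \<open>\<Sum>\<^sub>j M\<^sub>i\<^sub>j \<partial>\<^sub>j\<close>, a nonconstant common kernel element would give \<open>M\<close> a
  right kernel, hence a left kernel, that is, a linear relation between the derivations.
\<close>

lemma fibre_kernel_const:
  fixes f :: "'k::field_char_0 mvpoly"
  assumes f: "f \<in> carrier (mvpoly_ring n)"
    and iso: "k_alg_iso (fibre_ring n f \<alpha>) (\<lambda>c. fibre_ideal n f \<alpha> +>\<^bsub>mvpoly_ring n\<^esub> mvconst c)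
                    (mvpoly_ring m) mvconst"
    and D: "\<And>i. i < m \<Longrightarrow> derivation_on (carrier (mvpoly_ring n)) (D i)"
    and Dc: "\<And>i c. i < m \<Longrightarrow> D i (mvconst c) = 0"
    and Df: "\<And>i. i < m \<Longrightarrow> D i (f - mvconst \<alpha>) = 0"
    and indep: "\<And>c. \<forall>i<m. c i \<in> carrier (mvpoly_ring n) \<Longrightarrow>
      \<forall>x\<in>carrier (mvpoly_ring n). (\<Sum>i<m. c i * D i x) \<in> fibre_ideal n f \<alpha> \<Longrightarrow>
      \<forall>i<m. c i \<in> fibre_ideal n f \<alpha>"
    and a: "a \<in> carrier (mvpoly_ring n)" "\<And>i. i < m \<Longrightarrow> D i a \<in> fibre_ideal n f \<alpha>"
  shows "\<exists>c. a - mvconst c \<in> fibre_ideal n f \<alpha>"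
proof -
  let ?A = "carrier (mvpoly_ring n) :: 'k mvpoly set" and ?I = "fibre_ideal n f \<alpha>"
  let ?P = "carrier (mvpoly_ring m) :: 'k mvpoly set"
  interpret A: subdomain ?A by (rule subdomain_mvpoly)
  interpret P: subdomain ?P by (rule subdomain_mvpoly)
  obtain \<phi> where "\<phi> ` ?A = ?P"
    "\<forall>a\<in>?A. \<forall>b\<in>?A. \<phi> (a + b) = \<phi> a + \<phi> b" "\<forall>a\<in>?A. \<forall>b\<in>?A. \<phi> (a * b) = \<phi> a * \<phi> b"
    "\<forall>c. \<phi> (mvconst c) = mvconst c" "\<forall>a\<in>?A. \<phi> a = 0 \<longleftrightarrow> a \<in> ?I"
    by (rule fibre_iso_mvpoly[OF f iso])
  note \<phi> = this(1) this(2-5)[rule_format]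
  have const_mem: "mvconst c \<in> ?A" for c by simp
  have diff: "\<phi> (a - b) = \<phi> a - \<phi> b" if "a \<in> ?A" "b \<in> ?A" for a b
    using \<phi>(2)[OF A.minus_mem[OF that] that(2)] by simp
  have sum: "\<phi> (sum u J) = (\<Sum>i\<in>J. \<phi> (u i))" if "\<And>i. i \<in> J \<Longrightarrow> u i \<in> ?A" for u and J :: "nat set"
    using that \<phi>(4)[of 0]
    by (induction J rule: infinite_finite_induct)
      (simp_all add: \<phi>(2) A.sum_mem del: mvpoly_ring_simps)
  have lift: "\<exists>b. b \<in> ?A \<and> \<phi> b = p" if "p \<in> ?P" for p
    using that unfolding \<phi>(1)[symmetric] by blast
  have Dmem: "D i b \<in> ?A" if "i < m" "b \<in> ?A" for i b
    using A.derivation_mem[OF D] that .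
  \<comment> \<open>\<open>\<phi> (D i b)\<close> depends only on \<open>\<phi> b\<close>; this is
    the derivation induced on \<open>k^{[m]}\<close>, used without naming it.\<close>
  have cong: "\<phi> (D i b) = \<phi> (D i b')" if "i < m" "b \<in> ?A" "b' \<in> ?A" "\<phi> b = \<phi> b'" for i b b'
  proof -
    have "b - b' \<in> ?I" using that diff[OF that(2,3)] \<phi>(5)[OF A.minus_mem[OF that(2,3)]] by simp
    then have "D i (b - b') \<in> ?I" by (rule derivation_fibre_ideal[OF f D[OF that(1)] Df[OF that(1)]])
    then have "\<phi> (D i (b - b')) = 0"
      using \<phi>(5)[OF Dmem[OF that(1) A.minus_mem[OF that(2,3)]]] by simp
    then show ?thesis
      using diff[OF Dmem[OF that(1,2)] Dmem[OF that(1,3)]] A.derivation_minus[OF D[OF that(1)] that(2,3)]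
      by simp
  qed
  have "\<exists>b. j < m \<longrightarrow> b \<in> ?A \<and> \<phi> b = mvX j" for j
    using lift[of "mvX j"] by auto
  then obtain y where y: "\<And>j. j < m \<Longrightarrow> y j \<in> ?A" "\<And>j. j < m \<Longrightarrow> \<phi> (y j) = mvX j"
    by metis
  \<comment> \<open>Row \<open>i\<close> lists the values of the i-th induced derivation on the
    variables, computed on arbitrary lifts \<open>y j\<close>.\<close>
  define M where "M = (\<lambda>i j. \<phi> (D i (y j)))"
  have MP: "M i j \<in> ?P" if "i < m" "j < m" for i j
    unfolding M_def \<phi>(1)[symmetric] using Dmem[OF that(1) y(1)[OF that(2)]] by (rule imageI)
  \<comment> \<open>The induction is on the polynomial \<open>p\<close> in \<open>k^{[m]}\<close>
    while \<open>D i\<close> acts on \<open>A\<close>, so the claim is made for all preimages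
    \<open>b\<close> of \<open>p\<close>; sums and products may then use preimages of their
    own.\<close>
  have chain: "\<forall>b\<in>?A. \<phi> b = p \<longrightarrow> \<phi> (D i b) = (\<Sum>j<m. M i j * mvpartial j p)"
    if i: "i < m" and p: "p \<in> ?P" for i p
  proof -
    have "mvvars p \<subseteq> {..<m}" using p by simp
    then show ?thesis
    proof (induction rule: mvpoly_induct)
      case (const c)
      show ?case
      proof (intro ballI impI)
        fix b assume "b \<in> ?A" "\<phi> b = mvconst c"
        then have "\<phi> (D i b) = \<phi> (D i (mvconst c))"
          using \<phi>(4)[of c] by (intro cong i) simp_all
        then show "\<phi> (D i b) = (\<Sum>j<m. M i j * mvpartial j (mvconst c))"
          using \<phi>(4)[of 0] by (simp add: Dc i)
      qed
    next
      case (var k)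
      have s: "(\<Sum>j<m. M i j * mvpartial j (mvX k)) = M i k"
        unfolding mvpartial_mvX using var by (subst sum.remove[of _ k]) auto
      show ?case unfolding s unfolding M_def
        using cong[OF i _ y(1)[OF var]] y(2)[OF var] by simp
    next
      case (add p q)
      obtain b1 where b1: "b1 \<in> ?A" "\<phi> b1 = p" using lift[of p] add(1) by auto
      obtain b2 where b2: "b2 \<in> ?A" "\<phi> b2 = q" using lift[of q] add(2) by auto
      show ?case
      proof (intro ballI impI)
        fix b assume "b \<in> ?A" "\<phi> b = p + q"
        then have "\<phi> (D i b) = \<phi> (D i (b1 + b2))"
          using b1 b2 \<phi>(2)[OF b1(1) b2(1)] by (intro cong[OF i] A.add_mem) auto
        also have "\<dots> = \<phi> (D i b1) + \<phi> (D i b2)"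
          by (simp only: A.derivation_add[OF D[OF i] b1(1) b2(1)] \<phi>(2)[OF Dmem[OF i b1(1)] Dmem[OF i b2(1)]])
        finally show "\<phi> (D i b) = (\<Sum>j<m. M i j * mvpartial j (p + q))"
          using add(3,4) b1 b2 by (simp add: mvpartial_add distrib_left sum.distrib)
      qed
    next
      case (mult p q)
      obtain b1 where b1: "b1 \<in> ?A" "\<phi> b1 = p" using lift[of p] mult(1) by auto
      obtain b2 where b2: "b2 \<in> ?A" "\<phi> b2 = q" using lift[of q] mult(2) by auto
      note mem = Dmem[OF i b1(1)] Dmem[OF i b2(1)]
      show ?case
      proof (intro ballI impI)
        fix b assume "b \<in> ?A" "\<phi> b = p * q"
        then have "\<phi> (D i b) = \<phi> (D i (b1 * b2))"
          using b1 b2 \<phi>(3)[OF b1(1) b2(1)] by (intro cong[OF i] A.mult_mem) auto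
        also have "\<dots> = p * \<phi> (D i b2) + \<phi> (D i b1) * q"
          using b1 b2 mem
          by (simp add: A.derivation_mult[OF D[OF i]] \<phi>(2,3) A.mult_mem del: mvpoly_ring_simps)
        also have "\<dots> = (\<Sum>j<m. M i j * mvpartial j (p * q))"
          using mult(3,4) b1 b2
          by (simp add: mvpartial_mult sum.distrib sum_distrib_left algebra_simps)
        finally show "\<phi> (D i b) = (\<Sum>j<m. M i j * mvpartial j (p * q))" .
      qed
    qed
  qed
  have \<phi>P: "\<phi> b \<in> ?P" if "b \<in> ?A" for b using that unfolding \<phi>(1)[symmetric] by (rule imageI)
  have chain': "\<phi> (D i b) = (\<Sum>j<m. M i j * mvpartial j (\<phi> b))" if "i < m" "b \<in> ?A" for i b
    using chain[OF that(1) \<phi>P[OF that(2)]] that(2) by blast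
  have "mvpartial k (\<phi> a) = 0" if k: "k < m" for k
  proof (rule ccontr)
    assume ne: "mvpartial k (\<phi> a) \<noteq> 0"
    have "(\<Sum>j<m. M i j * mvpartial j (\<phi> a)) = 0" if "i < m" for i
      unfolding chain'[OF that a(1), symmetric] using \<phi>(5)[OF Dmem[OF that a(1)]] a(2)[OF that] by simp
    note rk = this
    \<comment> \<open>The gradient of \<open>\<phi> a\<close> is a nonzero right kernel vector of
      \<open>M\<close>. The left kernel vector it yields has entries in \<open>k^{[m]}\<close>, and
      its lift to \<open>A\<close> is a forbidden relation modulo the ideal.\<close>
    obtain c where c: "\<And>i. i \<in> {..<m} \<Longrightarrow> c i \<in> ?P" "\<exists>i\<in>{..<m}. c i \<noteq> 0"
        "\<And>j. j \<in> {..<m} \<Longrightarrow> (\<Sum>i<m. c i * M i j) = 0"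
      by (rule P.left_kernel_from_right_kernel[of "{..<m}" M "\<lambda>j. mvpartial j (\<phi> a)" k])
        (use MP k ne rk in \<open>auto simp del: mvpoly_ring_simps\<close>)
    have "\<exists>b. i < m \<longrightarrow> b \<in> ?A \<and> \<phi> b = c i" for i using lift[of "c i"] c(1)[of i] by auto
    then obtain C where C: "\<And>i. i < m \<Longrightarrow> C i \<in> ?A" "\<And>i. i < m \<Longrightarrow> \<phi> (C i) = c i" by metis
    have "(\<Sum>i<m. C i * D i x) \<in> ?I" if x: "x \<in> ?A" for x
    proof -
      have mem: "C i * D i x \<in> ?A" if "i < m" for i
        using A.mult_mem[OF C(1)[OF that] Dmem[OF that x]] .
      have "\<phi> (\<Sum>i<m. C i * D i x) = (\<Sum>i<m. \<phi> (C i * D i x))" using mem by (intro sum) simp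
      also have "\<dots> = (\<Sum>i<m. c i * (\<Sum>j<m. M i j * mvpartial j (\<phi> x)))"
      proof (intro sum.cong refl)
        fix i assume "i \<in> {..<m}"
        then have i: "i < m" by simp
        show "\<phi> (C i * D i x) = c i * (\<Sum>j<m. M i j * mvpartial j (\<phi> x))"
          by (simp only: \<phi>(3)[OF C(1)[OF i] Dmem[OF i x]] C(2)[OF i] chain'[OF i x])
      qed
      also have "\<dots> = (\<Sum>j<m. (\<Sum>i<m. c i * M i j) * mvpartial j (\<phi> x))"
        unfolding sum_distrib_left sum_distrib_right by (subst sum.swap) (simp add: mult.assoc)
      also have "\<dots> = 0" using c(3) by simp
      finally show ?thesis using \<phi>(5)[OF A.sum_mem[of "{..<m}"]] mem by simp
    qed
    then have "\<forall>i<m. C i \<in> ?I" using C(1) by (intro indep) auto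
    then have "c i = 0" if "i < m" for i using \<phi>(5)[OF C(1)[OF that]] C(2)[OF that] that by simp
    with c(2) show False by simp
  qed
  then obtain c where c: "\<phi> a = mvconst c"
    using mvconst_if_mvpartial_0[of "\<phi> a" m] \<phi>P[OF a(1)] by auto
  then have "\<phi> (a - mvconst c) = 0" using diff[OF a(1) const_mem] \<phi>(4) by simp
  then show ?thesis using \<phi>(5)[OF A.minus_mem[OF a(1) const_mem]] by blast
qed

text \<open>A unit would generate the whole ring and make the fibre zero, but 1 is nonzero in
  \<open>k^{[m]}\<close>, even for m = 0.\<close>

lemma fibre_affine_imp_nonunit:
  fixes f :: "'k::field_char_0 mvpoly"
  assumes f: "f \<in> carrier (mvpoly_ring n)"
    and iso: "k_alg_iso (fibre_ring n f \<alpha>) (\<lambda>c. fibre_ideal n f \<alpha> +>\<^bsub>mvpoly_ring n\<^esub> mvconst c)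
                    (mvpoly_ring m) mvconst"
    and q: "q \<in> carrier (mvpoly_ring n)"
  shows "q * (f - mvconst \<alpha>) \<noteq> 1"
proof
  assume "q * (f - mvconst \<alpha>) = 1"
  then have one: "1 \<in> fibre_ideal n f \<alpha>" using q unfolding fibre_ideal_iff by (metis (no_types))
  obtain \<phi> where "\<forall>c. \<phi> (mvconst c :: 'k mvpoly) = (mvconst c :: 'k mvpoly)"
    "\<forall>a\<in>carrier (mvpoly_ring n). \<phi> a = 0 \<longleftrightarrow> a \<in> fibre_ideal n f \<alpha>"
    by (rule fibre_iso_mvpoly[OF f iso])
  from this(1)[rule_format, of 1] bspec[OF this(2) subdomain.one_mem[OF subdomain_mvpoly]] one
  show False by simp
qed

text \<open>Applying \<open>mvconst\<close> to coefficients respects sums and products. The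
  polynomial \<open>P\<close> over k provides the degree and the roots on which
  \<open>slice_from_local_slice\<close> works.\<close>

lemma k_subalgebra_singleton:
  fixes f :: "'k::field_char_0 mvpoly"
  assumes "f \<in> carrier (mvpoly_ring n)" "a \<in> k_subalgebra (mvpoly_ring n) mvconst {f}"
  shows "\<exists>P. a = poly (map_poly mvconst P) f"
proof -
  have "{f} \<subseteq> carrier (mvpoly_ring n)" using assms(1) by simp
  from this assms(2) show ?thesis
  proof (induction rule: k_subalgebra_mvpoly_induct)
    case (const c)
    show ?case by (rule exI[of _ "[:c:]"]) (simp add: map_poly_pCons)
  next
    case (base s)
    then show ?case by (intro exI[of _ "[:0, 1:]"]) (simp add: map_poly_pCons)
  next
    case (add a b)
    then obtain P Q where "a = poly (map_poly mvconst P) f" "b = poly (map_poly mvconst Q) f" by blast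
    moreover have "map_poly mvconst (P + Q) = map_poly mvconst P + map_poly mvconst Q"
      by (rule poly_eqI) (simp add: coeff_map_poly mvconst_add)
    ultimately show ?case by (intro exI[of _ "P + Q"]) simp
  next
    case (mult a b)
    then obtain P Q where PQ: "a = poly (map_poly mvconst P) f" "b = poly (map_poly mvconst Q) f" by blast
    have add: "map_poly mvconst (P + Q) = map_poly mvconst P + (map_poly mvconst Q :: 'k mvpoly poly)" for P Q
      by (rule poly_eqI) (simp add: coeff_map_poly mvconst_add)
    have "map_poly mvconst (P * Q) = map_poly mvconst P * (map_poly mvconst Q :: 'k mvpoly poly)"
      by (induction P) (simp_all add: map_poly_pCons map_poly_smult add mvconst_mult)
    with PQ show ?case by (intro exI[of _ "P * Q"]) simp
  qed
qed

text \<open>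
  The factors \<open>f - \<alpha>\<close> of \<open>D\<^sub>i a \<in> k[f]\<close> are removed one at a time: modulo \<open>f - \<alpha>\<close> all \<open>D\<^sub>j a\<close> vanish,
  so \<open>a\<close> is a constant plus a multiple of \<open>f - \<alpha>\<close>.
\<close>

lemma slice_from_local_slice:
  fixes f :: "'k::{alg_closed_field,field_char_0} mvpoly"
  assumes f: "f \<in> carrier (mvpoly_ring n)"
    and D: "\<And>i. i < m \<Longrightarrow> derivation_on (carrier (mvpoly_ring n)) (D i)"
    and Dc: "\<And>i c. i < m \<Longrightarrow> D i (mvconst c) = 0"
    and Df: "\<And>i \<alpha>. i < m \<Longrightarrow> D i (f - mvconst \<alpha>) = 0"
    and f_ne: "\<And>\<alpha>. f - mvconst \<alpha> \<noteq> 0"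
    and fibre: "\<And>\<alpha> a. a \<in> carrier (mvpoly_ring n) \<Longrightarrow> (\<forall>i<m. D i a \<in> fibre_ideal n f \<alpha>) \<Longrightarrow>
      \<exists>c. a - mvconst c \<in> fibre_ideal n f \<alpha>"
    and i: "i < m" and P: "P \<noteq> 0"
    and a: "a \<in> carrier (mvpoly_ring n)" "D i a = poly (map_poly mvconst P) f"
      "\<forall>j<m. j \<noteq> i \<longrightarrow> D j a = 0"
  shows "\<exists>s\<in>carrier (mvpoly_ring n). \<forall>j<m. D j s = (if i = j then 1 else 0)"
  using P a
proof (induction "degree P" arbitrary: P a)
  case 0
  interpret A: subdomain "carrier (mvpoly_ring n) :: 'k mvpoly set" by (rule subdomain_mvpoly)
  obtain c where c: "P = [:c:]" using 0(1) by (metis degree_eq_zeroE)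
  with 0 have c0: "c \<noteq> 0" and Da: "D i a = mvconst c" by (auto simp: map_poly_pCons)
  have mem: "mvconst (inverse c) \<in> carrier (mvpoly_ring n)" by simp
  have "D j (mvconst (inverse c) * a) = mvconst (inverse c) * D j a" if "j < m" for j
    using A.derivation_constant_mult[OF D[OF that] mem 0(3) Dc[OF that]] .
  then have "D j (mvconst (inverse c) * a) = (if i = j then 1 else 0)" if "j < m" for j
    using that 0(5) c0 Da by (auto simp: mvconst_mult[symmetric])
  then show ?case using A.mult_mem[OF mem 0(3)] by blast
next
  case (Suc d)
  interpret A: subdomain "carrier (mvpoly_ring n) :: 'k mvpoly set" by (rule subdomain_mvpoly)
  \<comment> \<open>The degree is \<open>Suc d\<close>, so \<open>P\<close> has a root; the root
    selects the fibre on which \<open>a\<close> is examined.\<close>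
  obtain \<alpha> where "poly P \<alpha> = 0" using alg_closed_imp_poly_has_root[of P] Suc.hyps(2) by auto
  then obtain Q where Q: "P = [:- \<alpha>, 1:] * Q" by (auto simp: poly_eq_0_iff_dvd elim: dvdE)
  have Q0: "Q \<noteq> 0" using Suc.prems(1) Q by auto
  have "degree P = degree [:- \<alpha>, 1:] + degree Q"
    unfolding Q by (rule degree_mult_eq) (use Q0 in simp_all)
  then have deg: "degree Q = d" using Suc.hyps(2) by simp
  let ?ev = "\<lambda>P. poly (map_poly mvconst P) f"
  have mp: "map_poly mvconst P = pCons 0 (map_poly mvconst Q) - Polynomial.smult (mvconst \<alpha>) (map_poly mvconst Q)"
    by (rule poly_eqI)
      (simp add: Q coeff_map_poly coeff_pCons mvconst_minus mvconst_mult mvconst_add mvconst_uminus split: nat.split)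
  have ev: "?ev P = ?ev Q * (f - mvconst \<alpha>)" unfolding mp by (simp add: algebra_simps)
  have "poly (map_poly mvconst Q) f \<in> carrier (mvpoly_ring n)"
  proof (induction Q)
    case (pCons c Q)
    have "mvconst c \<in> carrier (mvpoly_ring n)" by simp
    with pCons f show ?case
      by (simp add: map_poly_pCons A.add_mem A.mult_mem del: mvpoly_ring_simps)
  qed (simp del: mvpoly_ring_simps add: A.zero_mem)
  then have "\<forall>j<m. D j a \<in> fibre_ideal n f \<alpha>"
    using Suc.prems(3,4) ev A.zero_mem unfolding fibre_ideal_iff
    by (metis mult_zero_left)
  then obtain c where "a - mvconst c \<in> fibre_ideal n f \<alpha>" using fibre[OF Suc.prems(2)] by blast
  then obtain b where b: "b \<in> carrier (mvpoly_ring n)" "a - mvconst c = b * (f - mvconst \<alpha>)"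
    by (auto simp: fibre_ideal_iff)
  have Da: "D j a = D j b * (f - mvconst \<alpha>)" if j: "j < m" for j
  proof -
    have "D j (a - mvconst c) = D j a"
      using A.derivation_minus[OF D[OF j] Suc.prems(2), of "mvconst c"] Dc[OF j] by simp
    moreover have "D j (b * (f - mvconst \<alpha>)) = D j b * (f - mvconst \<alpha>)"
      using A.derivation_mult[OF D[OF j] b(1) fibre_gen_mem[OF f]] Df[OF j] by simp
    ultimately show ?thesis using b(2) by simp
  qed
  \<comment> \<open>Both sides of \<open>D i a = P(f)\<close> contain the nonzero factor f -
    \<alpha>, which cancels and leaves a quotient \<open>Q\<close> of smaller degree.\<close>
  have "D i b = ?ev Q" using Da[OF i] Suc.prems(3) ev f_ne[of \<alpha>] by simp
  moreover have "\<forall>j<m. j \<noteq> i \<longrightarrow> D j b = 0" using Da Suc.prems(4) f_ne[of \<alpha>] by fastforce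
  ultimately show ?case using Suc.hyps(1)[of Q b] deg Q0 b(1) by blast
qed

text \<open>A relation over \<open>A\<close> is one modulo \<open>p\<close>, so all its coefficients
  are divisible by \<open>p\<close>, and the quotients again satisfy a relation. Repetition makes
  each coefficient divisible by every power of \<open>p\<close>, against
  \<open>finite_divisibility\<close>.\<close>

lemma independent_if_independent_mod:
  fixes p :: "'k::field_char_0 mvpoly"
  assumes p: "p \<in> carrier (mvpoly_ring n)" "p \<noteq> 0"
    and nonunit: "\<And>q. q \<in> carrier (mvpoly_ring n) \<Longrightarrow> q * p \<noteq> 1"
    and indep: "\<And>c. \<forall>i<m. c i \<in> carrier (mvpoly_ring n) \<Longrightarrow>
      \<forall>x\<in>carrier (mvpoly_ring n). \<exists>q\<in>carrier (mvpoly_ring n). (\<Sum>i<m. c i * D i x) = q * p \<Longrightarrow>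
      \<forall>i<m. \<exists>q\<in>carrier (mvpoly_ring n). c i = q * p"
    and c: "\<forall>i<m. c i \<in> carrier (mvpoly_ring n)"
    and 0: "\<forall>x\<in>carrier (mvpoly_ring n). (\<Sum>i<m. c i * D i x) = 0"
    and i: "i < (m::nat)"
  shows "c i = 0"
proof (rule ccontr)
  assume "c i \<noteq> 0"
  then obtain N where N: "\<forall>q\<in>carrier (mvpoly_ring n). c i \<noteq> q * p ^ N"
    using finite_divisibility[OF p(1) nonunit] c i by blast
  \<comment> \<open>\<open>b\<close> is the quotient of \<open>c\<close> by \<open>p ^ N\<close>; it
    stays a relation because \<open>p\<close> cancels in a domain.\<close>
  have "\<exists>b. (\<forall>i<m. b i \<in> carrier (mvpoly_ring n) \<and> c i = b i * p ^ N) \<and>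
      (\<forall>x\<in>carrier (mvpoly_ring n). (\<Sum>i<m. b i * D i x) = 0)"
  proof (induction N)
    case 0
    show ?case using c assms(6) by (intro exI[of _ c]) simp
  next
    case (Suc N)
    then obtain b where b: "\<forall>i<m. b i \<in> carrier (mvpoly_ring n)" "\<forall>i<m. c i = b i * p ^ N"
      "\<forall>x\<in>carrier (mvpoly_ring n). (\<Sum>i<m. b i * D i x) = 0" by blast
    have "\<forall>i<m. \<exists>q\<in>carrier (mvpoly_ring n). b i = q * p"
      using b subdomain.zero_mem[OF subdomain_mvpoly]
      by (intro indep) (auto intro!: bexI[of _ 0] simp del: mvpoly_ring_simps)
    then obtain q where q: "\<And>i. i < m \<Longrightarrow> q i \<in> carrier (mvpoly_ring n)" "\<And>i. i < m \<Longrightarrow> b i = q i * p"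
      by metis
    have "(\<Sum>i<m. q i * D i x) = 0" if "x \<in> carrier (mvpoly_ring n)" for x
    proof -
      have "p * (\<Sum>i<m. q i * D i x) = (\<Sum>i<m. b i * D i x)"
        unfolding sum_distrib_left by (intro sum.cong refl) (simp add: q(2) mult_ac)
      then show ?thesis using b(3) that p(2) by (simp del: mvpoly_ring_simps)
    qed
    moreover have "c i = q i * p ^ Suc N" if "i < m" for i
      using b(2) q(2)[OF that] that by (simp add: mult_ac)
    ultimately show ?case using q(1) by blast
  qed
  with N i show False by blast
qed

text \<open>For n = 1 the family of derivations is empty, its joint kernel is the whole ring, and
  the kernel hypothesis already says that \<open>f\<close> generates. Otherwise the missing
  generators are the slices.\<close>

lemma commuting_derivations_imp_coordinate:
  fixes f :: "'k::{alg_closed_field,field_char_0} mvpoly"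
  assumes n: "n \<ge> 1" and f: "f \<in> carrier (mvpoly_ring n)" and affine: "all_fibres_affine n f"
    and D: "\<forall>i<n-1. k_derivation (mvpoly_ring n) mvconst (D i) \<and>
                     locally_nilpotent (mvpoly_ring n) (D i)"
    and comm: "\<forall>i<n-1. \<forall>j<n-1. \<forall>a\<in>carrier (mvpoly_ring n). D i (D j a) = D j (D i a)"
    and ker: "common_kernel (mvpoly_ring n) (n - 1) D = k_subalgebra (mvpoly_ring n) mvconst {f}"
    and indep: "\<forall>\<alpha>. lin_indep_maps (fibre_ring n f \<alpha>) (n - 1)
                  (\<lambda>i. induced_map (mvpoly_ring n) (fibre_ideal n f \<alpha>) (D i))"
  shows "coordinate n f"
proof -
  let ?A = "carrier (mvpoly_ring n) :: 'k mvpoly set"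
  define m where "m = n - 1"
  have Dd: "derivation_on ?A (D i)" and Dc: "D i (mvconst c) = 0" and Dn: "nilpotent_on ?A (D i)"
    if "i < m" for i c
    using D that by (auto simp: k_derivation_mvpoly_iff locally_nilpotent_mvpoly_iff m_def
        simp del: mvpoly_ring_simps)
  interpret D: commuting_lnds ?A "{..<m}" D
    by (intro commuting_lnds.intro subdomain_mvpoly commuting_lnds_axioms.intro)
      (use Dd Dn comm in \<open>simp_all add: m_def del: mvpoly_ring_simps\<close>)
  have iso: "k_alg_iso (fibre_ring n f \<alpha>) (\<lambda>c. fibre_ideal n f \<alpha> +>\<^bsub>mvpoly_ring n\<^esub> mvconst c)
                    (mvpoly_ring m) mvconst" for \<alpha>
    using affine by (simp add: all_fibres_affine_def m_def)
  have fsub: "{f} \<subseteq> ?A" using f by simp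
  have kerJ: "D.joint_ker {..<m} = k_subalgebra (mvpoly_ring n) mvconst {f}"
    unfolding ker[symmetric] by (auto simp: common_kernel_def D.joint_ker_def m_def)
  have "f \<in> D.joint_ker {..<m}" unfolding kerJ using k_subalgebra_mvpoly(3)[OF fsub] by simp
  then have "D i f = 0" if "i < m" for i using that by (simp add: D.joint_ker_def)
  then have Df: "D i (f - mvconst \<alpha>) = 0" if "i < m" for i \<alpha>
    using D.derivation_minus[OF Dd[OF that] f, of "mvconst \<alpha>"] Dc[OF that] that by simp
  have indep': "\<forall>i<m. c i \<in> fibre_ideal n f \<alpha>"
    if "\<forall>i<m. c i \<in> ?A" "\<forall>x\<in>?A. (\<Sum>i<m. c i * D i x) \<in> fibre_ideal n f \<alpha>" for c \<alpha>
  proof -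
    have "lin_indep_maps (fibre_ring n f \<alpha>) m
        (\<lambda>i. induced_map (mvpoly_ring n) (fibre_ideal n f \<alpha>) (D i)) \<longleftrightarrow>
      (\<forall>c. (\<forall>i<m. c i \<in> ?A) \<longrightarrow> (\<forall>x\<in>?A. (\<Sum>i<m. c i * D i x) \<in> fibre_ideal n f \<alpha>) \<longrightarrow>
        (\<forall>i<m. c i \<in> fibre_ideal n f \<alpha>))"
      by (rule lin_indep_fibre_iff[OF f Dd Df])
    from iffD1[OF this indep[rule_format, of \<alpha>, folded m_def], THEN spec, THEN mp, THEN mp, OF that]
    show ?thesis .
  qed
  have f_ne: "f - mvconst \<alpha> \<noteq> 0" for \<alpha>
  proof
    assume "f - mvconst \<alpha> = 0"
    \<comment> \<open>If \<open>f\<close> were the constant \<alpha>, the neighbouring fibre over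
      \<alpha> - 1 would be cut out by a unit.\<close>
    then have "1 * (f - mvconst (\<alpha> - 1)) = 1" by (simp add: mvconst_minus)
    then show False using fibre_affine_imp_nonunit[OF f iso D.one_mem] by blast
  qed
  \<comment> \<open>Independence over \<open>A\<close> is read off the fibre over 0.\<close>
  have "D.independent_on {}"
    unfolding D.independent_on_def
  proof (intro allI impI ballI)
    fix c i
    assume c: "\<forall>i\<in>{..<m} - {}. c i \<in> ?A" "\<forall>x\<in>D.joint_ker {}. (\<Sum>i\<in>{..<m} - {}. c i * D i x) = 0"
      and i: "i \<in> {..<m} - {}"
    show "c i = 0"
    proof (rule independent_if_independent_mod)
      show "f - mvconst 0 \<in> ?A" by (rule fibre_gen_mem[OF f])
      show "f - mvconst 0 \<noteq> 0" by (rule f_ne)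
      show "q * (f - mvconst 0) \<noteq> 1" if "q \<in> ?A" for q
        by (rule fibre_affine_imp_nonunit[OF f iso that])
      show "\<forall>i<m. \<exists>q\<in>?A. c i = q * (f - mvconst 0)"
        if "\<forall>i<m. c i \<in> ?A" "\<forall>x\<in>?A. \<exists>q\<in>?A. (\<Sum>i<m. c i * D i x) = q * (f - mvconst 0)" for c
        using indep'[of c 0, unfolded fibre_ideal_iff, OF that] .
      show "\<forall>i<m. c i \<in> ?A" using c(1) by simp
      show "\<forall>x\<in>?A. (\<Sum>i<m. c i * D i x) = 0" using c(2) by (simp add: D.joint_ker_def)
      show "i < m" using i by simp
    qed
  qed
  note ind = this
  have "\<exists>s\<in>?A. \<forall>j<m. D j s = (if i = j then 1 else 0)" if i: "i < m" for i
  proof -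
    have iI: "i \<in> {..<m}" using i by simp
    obtain a where a: "a \<in> ?A" "D i a \<in> D.joint_ker {..<m}" "D i a \<noteq> 0"
        "\<And>j. j \<in> {..<m} \<Longrightarrow> j \<noteq> i \<Longrightarrow> D j a = 0"
      using D.local_slices[OF ind iI] by metis
    obtain P where P: "D i a = poly (map_poly mvconst P) f"
      using k_subalgebra_singleton[OF f] a(2) unfolding kerJ by blast
    show ?thesis
    proof (rule slice_from_local_slice[where D = D and P = P and a = a])
      show "\<exists>c. b - mvconst c \<in> fibre_ideal n f \<alpha>"
        if b: "b \<in> ?A" "\<forall>i<m. D i b \<in> fibre_ideal n f \<alpha>" for \<alpha> b
      proof (rule fibre_kernel_const[where D = D, OF f iso])
        show "D i b \<in> fibre_ideal n f \<alpha>" if "i < m" for i using b(2) that by blast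
        show "\<forall>i<m. c i \<in> fibre_ideal n f \<alpha>"
          if "\<forall>i<m. c i \<in> ?A" "\<forall>x\<in>?A. (\<Sum>i<m. c i * D i x) \<in> fibre_ideal n f \<alpha>" for c
          using indep'[OF that] .
      qed (rule Dd Dc Df b(1), assumption?)+
      show "P \<noteq> 0" using a(3) P by auto
      show "\<forall>j<m. j \<noteq> i \<longrightarrow> D j a = 0" using a(4) by simp
    qed (rule f Dd Dc Df f_ne i a(1) P, assumption?)+
  qed
  then obtain s where s: "\<And>i. i < m \<Longrightarrow> s i \<in> ?A"
    "\<And>i j. i < m \<Longrightarrow> j < m \<Longrightarrow> D j (s i) = (if i = j then 1 else 0)"
    by metis
  \<comment> \<open>\<open>g 0 = f\<close> as \<open>coordinate\<close> demands, and
    \<open>g (Suc i) = s i\<close>.\<close>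
  define g where "g = case_nat f s"
  have g: "g i \<in> ?A" if "i < n" for i
    using that f s(1) by (cases i) (simp_all add: g_def m_def del: mvpoly_ring_simps)
  then have gsub: "g ` {..<n} \<subseteq> ?A" by blast
  let ?T = "k_subalgebra (mvpoly_ring n) mvconst (g ` {..<n})"
  note T = k_subalgebra_mvpoly[OF gsub]
  have gT: "g i \<in> ?T" if "i < n" for i using T(3) that by auto
  have fT: "f \<in> ?T" using gT[of 0] n by (simp add: g_def)
  have sT: "s i \<in> ?T" if "i < m" for i
    using gT[of "Suc i"] that by (simp add: g_def m_def)
  have "?A \<subseteq> ?T"
  proof (rule D.slices_generate[of s])
    show "D.joint_ker {..<m} \<subseteq> ?T"
    proof
      fix a assume "a \<in> D.joint_ker {..<m}"
      then have "a \<in> k_subalgebra (mvpoly_ring n) mvconst {f}" by (simp only: kerJ)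
      with fsub show "a \<in> ?T"
        by (induction rule: k_subalgebra_mvpoly_induct) (use T fT in auto)
    qed
    show "a \<in> ?T" if "fact j * a \<in> ?T" for j a by (rule k_subalgebra_fact_cancel[OF gsub that])
    show "a + b \<in> ?T" if "a \<in> ?T" "b \<in> ?T" for a b by (rule T(4)[OF that])
    show "a * b \<in> ?T" if "a \<in> ?T" "b \<in> ?T" for a b by (rule T(5)[OF that])
  qed (use s sT in \<open>simp_all del: mvpoly_ring_simps\<close>)
  then have "?T = ?A" using T(1) by blast
  then show ?thesis
    unfolding coordinate_def using g by (intro exI[of _ g]) (simp add: g_def del: mvpoly_ring_simps)
qed

theorem mainTheorem3:
  fixes n :: nat
  assumes "n \<ge> 1"
  shows
    "(\<forall>f :: 'k::{alg_closed_field, field_char_0} mvpoly. f \<in> carrier (mvpoly_ring n) \<longrightarrow>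
        all_fibres_affine n f \<longrightarrow> coordinate n f)
     \<longleftrightarrow>
     (\<forall>f :: 'k mvpoly. f \<in> carrier (mvpoly_ring n) \<longrightarrow>
        all_fibres_affine n f \<longrightarrow>
        (\<exists>D :: nat \<Rightarrow> 'k mvpoly \<Rightarrow> 'k mvpoly.
           (\<forall>i<n-1. k_derivation (mvpoly_ring n) mvconst (D i) \<and>
                     locally_nilpotent (mvpoly_ring n) (D i)) \<and>
           (\<forall>i<n-1. \<forall>j<n-1. \<forall>a\<in>carrier (mvpoly_ring n). D i (D j a) = D j (D i a)) \<and>
           common_kernel (mvpoly_ring n) (n - 1) D = k_subalgebra (mvpoly_ring n) mvconst {f} \<and>
           (\<forall>\<alpha>. lin_indep_maps (fibre_ring n f \<alpha>) (n - 1)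
                  (\<lambda>i. induced_map (mvpoly_ring n) (fibre_ideal n f \<alpha>) (D i)))))"
proof (intro iffI allI impI)
  fix f :: "'k mvpoly"
  assume SC: "\<forall>f :: 'k mvpoly. f \<in> carrier (mvpoly_ring n) \<longrightarrow> all_fibres_affine n f \<longrightarrow> coordinate n f"
    and f: "f \<in> carrier (mvpoly_ring n)" "all_fibres_affine n f"
  from SC[rule_format, OF f] show "\<exists>D :: nat \<Rightarrow> 'k mvpoly \<Rightarrow> 'k mvpoly.
           (\<forall>i<n-1. k_derivation (mvpoly_ring n) mvconst (D i) \<and>
                     locally_nilpotent (mvpoly_ring n) (D i)) \<and>
           (\<forall>i<n-1. \<forall>j<n-1. \<forall>a\<in>carrier (mvpoly_ring n). D i (D j a) = D j (D i a)) \<and>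
           common_kernel (mvpoly_ring n) (n - 1) D = k_subalgebra (mvpoly_ring n) mvconst {f} \<and>
           (\<forall>\<alpha>. lin_indep_maps (fibre_ring n f \<alpha>) (n - 1)
                  (\<lambda>i. induced_map (mvpoly_ring n) (fibre_ideal n f \<alpha>) (D i)))"
    by (rule coordinate_imp_commuting_derivations[OF assms])
next
  fix f :: "'k mvpoly"
  assume MSC: "\<forall>f :: 'k mvpoly. f \<in> carrier (mvpoly_ring n) \<longrightarrow> all_fibres_affine n f \<longrightarrow>
        (\<exists>D :: nat \<Rightarrow> 'k mvpoly \<Rightarrow> 'k mvpoly.
           (\<forall>i<n-1. k_derivation (mvpoly_ring n) mvconst (D i) \<and>
                     locally_nilpotent (mvpoly_ring n) (D i)) \<and>
           (\<forall>i<n-1. \<forall>j<n-1. \<forall>a\<in>carrier (mvpoly_ring n). D i (D j a) = D j (D i a)) \<and>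
           common_kernel (mvpoly_ring n) (n - 1) D = k_subalgebra (mvpoly_ring n) mvconst {f} \<and>
           (\<forall>\<alpha>. lin_indep_maps (fibre_ring n f \<alpha>) (n - 1)
                  (\<lambda>i. induced_map (mvpoly_ring n) (fibre_ideal n f \<alpha>) (D i))))"
    and f: "f \<in> carrier (mvpoly_ring n)" "all_fibres_affine n f"
  from MSC[rule_format, OF f] show "coordinate n f"
    by (elim exE conjE) (rule commuting_derivations_imp_coordinate[OF assms f])
qed

end
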